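(* Let $0<\alpha\le\alpha_0=(13-3\sqrt{17})/4=0.15767\ldots$. Let $f\in\mathcal H_{(d)}$ and $x\in\mathbb C^{n+1}$ be nonzero with $\operatorname{rank}Df(x)|_{x^\perp}=n$ and \[\frac{D^{3/2}}{2}\mu(f,x)\beta_0(f,x)\le\alpha.\] Then there is a zero $\zeta\in\mathbb C^{n+1}$ of $f$ with $d_T(x,\zeta)\le\sigma(\alpha)\beta_0(f,x)$, where $\sigma(\alpha)=\frac14+\frac{1-\sqrt{(1+\alpha)^2-8\alpha}}{4\alpha}$. Furthermore, with $y=N_f(x)$, $d_R(y,\zeta)\le(\sigma(\alpha)-1)\beta_0(f,x)$. Moreover, if $\alpha\le0.049$, then $x$ is an approximate zero of $f$ with associated zero $\zeta$, and so is $y$.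
   Context: $n\ge2$, $(d)=(d_1,\dots,d_n)$, $D=\max_i d_i\ge2$. $\mathcal H_{(d)}$: systems of $n$ homogeneous complex polynomials in $n+1$ variables of degrees $d_i$ with the Bombieri–Weyl inner product $\langle f,g\rangle=\sum_i\sum_{|\alpha|=d_i}\frac{\alpha_0!\cdots\alpha_n!}{d_i!}f_{i,\alpha}\overline{g_{i,\alpha}}$. $x^\perp$ is the Hermitian orthogonal complement of $x$. $\mu(f,x)=\|f\|\,\|(Df(x)|_{x^\perp})^{-1}\mathrm{diag}(\sqrt{d_i}\|x\|^{d_i-1})\|$ (operator norm). $\beta_0(f,x)=\|x\|^{-1}\|(Df(x)|_{x^\perp})^{-1}f(x)\|$. $N_f(x)=x-(Df(x)|_{x^\perp})^{-1}f(x)$. $d_R(x,y)\in[0,\pi/2]$ with $\cos d_R=|\langle x,y\rangle|/(\|x\|\|y\|)$, $d_T=\tan d_R$. A nonzero $x$ is an approximate zero of $f$ with associated zero $\zeta$ ($f(\zeta)=0$) if $x_0=x$, $x_p=N_f(x_{p-1})$ are defined for all $p\ge1$ and $d_T(\zeta,x_p)\le(1/2)^{2^p-1}d_T(\zeta,x)$. *)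

theory Defs
  imports "HOL-Analysis.Analysis"
begin

text \<open>Variables are indexed by a finite type 'n (playing the role of {0..n}, so CARD('n) = n+1);
equations are indexed by a finite type 'm (CARD('m) = n).  A system f of homogeneous polynomials
is given by its coefficient function: f i a is the coefficient of the monomial
prod_j X_j^(a j) in the i-th polynomial.\<close>

definition monoms :: "nat \<Rightarrow> ('n::finite \<Rightarrow> nat) set" where
  "monoms k = {a. (\<Sum>j\<in>UNIV. a j) = k}"

definition in_Hd :: "('m::finite \<Rightarrow> nat) \<Rightarrow> ('m \<Rightarrow> ('n::finite \<Rightarrow> nat) \<Rightarrow> complex) \<Rightarrow> bool" where
  "in_Hd d f \<longleftrightarrow> (\<forall>i a. f i a \<noteq> 0 \<longrightarrow> (\<Sum>j\<in>UNIV. a j) = d i)"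

definition peval :: "('m::finite \<Rightarrow> nat) \<Rightarrow> ('m \<Rightarrow> ('n::finite \<Rightarrow> nat) \<Rightarrow> complex) \<Rightarrow> complex^'n \<Rightarrow> complex^'m" where
  "peval d f x = (\<chi> i. \<Sum>a\<in>monoms (d i). f i a * (\<Prod>j\<in>UNIV. (x$j) ^ (a j)))"

definition BWnorm :: "('m::finite \<Rightarrow> nat) \<Rightarrow> ('m \<Rightarrow> ('n::finite \<Rightarrow> nat) \<Rightarrow> complex) \<Rightarrow> real" where
  "BWnorm d f = sqrt (\<Sum>i\<in>UNIV. \<Sum>a\<in>monoms (d i).
      (\<Prod>j\<in>UNIV. fact (a j)) / fact (d i) * (cmod (f i a))^2)"

definition Jac :: "('m::finite \<Rightarrow> nat) \<Rightarrow> ('m \<Rightarrow> ('n::finite \<Rightarrow> nat) \<Rightarrow> complex) \<Rightarrow> complex^'n \<Rightarrow> complex^'n^'m" where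
  "Jac d f x = (\<chi> i j. \<Sum>a\<in>monoms (d i). f i a * of_nat (a j) *
      (\<Prod>k\<in>UNIV. if k = j then (x$k) ^ (a k - 1) else (x$k) ^ (a k)))"

definition hinner :: "complex^'n::finite \<Rightarrow> complex^'n \<Rightarrow> complex" where
  "hinner x y = (\<Sum>j\<in>UNIV. x$j * cnj (y$j))"

definition perp :: "complex^'n::finite \<Rightarrow> (complex^'n) set" where
  "perp x = {v. hinner v x = 0}"

definition RInv :: "('m::finite \<Rightarrow> nat) \<Rightarrow> ('m \<Rightarrow> ('n::finite \<Rightarrow> nat) \<Rightarrow> complex) \<Rightarrow> complex^'n \<Rightarrow> complex^'m \<Rightarrow> complex^'n" where
  "RInv d f x w = (THE v. v \<in> perp x \<and> Jac d f x *v v = w)"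

definition mu :: "('m::finite \<Rightarrow> nat) \<Rightarrow> ('m \<Rightarrow> ('n::finite \<Rightarrow> nat) \<Rightarrow> complex) \<Rightarrow> complex^'n \<Rightarrow> real" where
  "mu d f x = BWnorm d f *
     onorm (\<lambda>w. RInv d f x (\<chi> i. complex_of_real (sqrt (real (d i)) * norm x ^ (d i - 1)) * w$i))"

definition beta0 :: "('m::finite \<Rightarrow> nat) \<Rightarrow> ('m \<Rightarrow> ('n::finite \<Rightarrow> nat) \<Rightarrow> complex) \<Rightarrow> complex^'n \<Rightarrow> real" where
  "beta0 d f x = norm (RInv d f x (peval d f x)) / norm x"

definition newton :: "('m::finite \<Rightarrow> nat) \<Rightarrow> ('m \<Rightarrow> ('n::finite \<Rightarrow> nat) \<Rightarrow> complex) \<Rightarrow> complex^'n \<Rightarrow> complex^'n" where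
  "newton d f x = x - RInv d f x (peval d f x)"

definition newton_defined :: "('m::finite \<Rightarrow> nat) \<Rightarrow> ('m \<Rightarrow> ('n::finite \<Rightarrow> nat) \<Rightarrow> complex) \<Rightarrow> complex^'n \<Rightarrow> bool" where
  "newton_defined d f x \<longleftrightarrow> x \<noteq> 0 \<and> bij_betw (\<lambda>v. Jac d f x *v v) (perp x) UNIV"

definition dR :: "complex^'n::finite \<Rightarrow> complex^'n \<Rightarrow> real" where
  "dR x y = arccos (cmod (hinner x y) / (norm x * norm y))"

definition dT :: "complex^'n::finite \<Rightarrow> complex^'n \<Rightarrow> ereal" where
  "dT x y = (if dR x y = pi / 2 then PInfty else ereal (tan (dR x y)))"

definition approx_zero :: "('m::finite \<Rightarrow> nat) \<Rightarrow> ('m \<Rightarrow> ('n::finite \<Rightarrow> nat) \<Rightarrow> complex) \<Rightarrow> complex^'n \<Rightarrow> complex^'n \<Rightarrow> bool" where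
  "approx_zero d f x \<zeta> \<longleftrightarrow> x \<noteq> 0 \<and> peval d f \<zeta> = 0 \<and>
     (\<forall>p. newton_defined d f ((newton d f ^^ p) x)) \<and>
     (\<forall>p\<ge>1. dT \<zeta> ((newton d f ^^ p) x) \<le> ereal ((1/2) ^ (2^p - 1)) * dT \<zeta> x)"

definition sigma :: "real \<Rightarrow> real" where
  "sigma a = 1/4 + (1 - sqrt ((1 + a)^2 - 8 * a)) / (4 * a)"

end

theory Submission
  imports Defs
begin

text \<open>
  In the chart \<open>x + perp x\<close> write \<open>A\<close> for the inverse of \<open>Df(x)\<close> on \<open>perp x\<close>. The Bombieri--Weyl
  bounds on higher derivatives make the Taylor series of \<open>A f\<close> at \<open>x\<close> majorised by the geometric
  series with ratio \<open>G = D\<^sup>3\<^sup>/\<^sup>2 \<mu> / 2\<close>; here the weak bound \<open>\<mu> \<surd>D \<ge> 1\<close> suffices. The number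
  \<open>t = \<sigma>(\<alpha>) \<beta>\<^sub>0\<close> is a fixed point of the majorant \<open>\<beta>\<^sub>0 + G t\<^sup>2 / (1 - G t)\<close>, so \<open>v \<mapsto> v - A f(x + v)\<close>
  maps a ball of \<open>perp x\<close> to itself. Brouwer's theorem gives the zero, and the same estimate
  bounds its distance from the Newton iterate.

  For \<open>\<alpha> \<le> 0.049\<close> the condition number at most doubles when one moves from \<open>x\<close> to \<open>\<zeta>\<close> and from
  there to any point no farther from \<open>\<zeta>\<close> than \<open>\<sigma>(\<alpha>) \<beta>\<^sub>0\<close>. The Newton error at such a point is a second
  order Taylor remainder, hence quadratically small with a constant \<open>K\<close> satisfying
  \<open>K \<sigma>(\<alpha>) \<beta>\<^sub>0 \<le> 1/2\<close>.
\<close>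

subsection \<open>Directional derivatives of homogeneous polynomials\<close>

definition hev :: "nat \<Rightarrow> (('n::finite \<Rightarrow> nat) \<Rightarrow> complex) \<Rightarrow> complex^'n \<Rightarrow> complex" where
  "hev k c x = (\<Sum>a\<in>monoms k. c a * (\<Prod>j\<in>UNIV. (x$j) ^ (a j)))"

definition bw :: "nat \<Rightarrow> (('n::finite \<Rightarrow> nat) \<Rightarrow> complex) \<Rightarrow> real" where
  "bw k c = sqrt (\<Sum>a\<in>monoms k. (\<Prod>j\<in>UNIV. fact (a j)) / fact k * (cmod (c a))^2)"

text \<open>The derivative along \<open>v\<close>, acting on coefficients alone. It carries no
  degree, so it can be iterated freely and no analytic derivative is needed.\<close>

definition dirder :: "complex^'n::finite \<Rightarrow> (('n \<Rightarrow> nat) \<Rightarrow> complex) \<Rightarrow> ('n \<Rightarrow> nat) \<Rightarrow> complex" where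
  "dirder v c b = (\<Sum>j\<in>UNIV. v$j * of_nat (Suc (b j)) * c (b(j := Suc (b j))))"

lemma finite_monoms [simp]: "finite (monoms k :: ('n::finite \<Rightarrow> nat) set)"
proof -
  have "a j \<le> k" if "a \<in> monoms k" for a :: "'n \<Rightarrow> nat" and j
    using that member_le_sum[of j UNIV a] by (auto simp: monoms_def)
  then have "monoms k \<subseteq> (UNIV :: 'n set) \<rightarrow>\<^sub>E {..k}"
    by (auto simp: PiE_def Pi_def)
  moreover have "finite ((UNIV :: 'n set) \<rightarrow>\<^sub>E {..k})"
    by (intro finite_PiE) auto
  ultimately show ?thesis by (rule finite_subset)
qed

lemma monoms_0: "monoms 0 = {\<lambda>_::'n::finite. 0}"
  by (auto simp: monoms_def)

lemma sum_fun_upd_Suc: "(\<Sum>i\<in>UNIV. (b(j := Suc (b j))) i) = Suc (\<Sum>i\<in>UNIV. b (i::'n::finite))"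
  by (subst (1 2) sum.remove[of UNIV j]) (auto intro!: sum.cong)

text \<open>Raising exponent \<open>j\<close> is a bijection from \<open>monoms k\<close> onto the
  monomials of degree \<open>Suc k\<close> that contain variable \<open>j\<close>; the weight
  \<open>a j\<close> kills the others.\<close>

lemma sum_monoms_Suc:
  fixes h :: "('n::finite \<Rightarrow> nat) \<Rightarrow> 'a::comm_semiring_1"
  shows "(\<Sum>b\<in>monoms k. of_nat (Suc (b j)) * h (b(j := Suc (b j))))
       = (\<Sum>a\<in>monoms (Suc k). of_nat (a j) * h a)"
proof -
  have "(\<Sum>a\<in>monoms (Suc k). of_nat (a j) * h a)
      = (\<Sum>a\<in>{a\<in>monoms (Suc k). a j > 0}. of_nat (a j) * h a)"
    by (rule sum.mono_neutral_right) auto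
  also have "\<dots> = (\<Sum>b\<in>monoms k. of_nat (Suc (b j)) * h (b(j := Suc (b j))))"
  proof (rule sum.reindex_bij_witness[where i = "\<lambda>b. b(j := Suc (b j))" and j = "\<lambda>a. a(j := a j - 1)"])
    fix a assume a: "a \<in> {a\<in>monoms (Suc k). a j > 0}"
    show "a(j := a j - 1, j := Suc ((a(j := a j - 1)) j)) = a"
      using a by auto
    have "(\<Sum>i\<in>UNIV. a i) = Suc (\<Sum>i\<in>UNIV. (a(j := a j - 1)) i)"
      using sum_fun_upd_Suc[of "a(j := a j - 1)" j] a by (simp del: fun_upd_apply) (simp add: fun_upd_idem)
    then show "a(j := a j - 1) \<in> monoms k"
      using a by (auto simp: monoms_def)
    show "of_nat (Suc ((a(j := a j - 1)) j)) * h (a(j := a j - 1, j := Suc ((a(j := a j - 1)) j)))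
      = of_nat (a j) * h a"
      using a by auto
  next
    fix b :: "'n \<Rightarrow> nat" assume b: "b \<in> monoms k"
    show "(b(j := Suc (b j)))(j := (b(j := Suc (b j))) j - 1) = b" by auto
    show "b(j := Suc (b j)) \<in> {a\<in>monoms (Suc k). a j > 0}"
      using b sum_fun_upd_Suc[of b j] by (auto simp: monoms_def simp del: fun_upd_apply) auto
  qed
  finally show ?thesis by simp
qed

lemma bw_nonneg [simp]: "0 \<le> bw k c"
  by (auto simp: bw_def intro!: sum_nonneg mult_nonneg_nonneg divide_nonneg_pos prod_nonneg)

lemma bw_power2:
  "(bw k c)\<^sup>2 = (\<Sum>a\<in>monoms k. (\<Prod>j\<in>UNIV. fact (a j)) / fact k * (cmod (c a))\<^sup>2)"
  by (auto simp: bw_def intro!: real_sqrt_pow2 sum_nonneg mult_nonneg_nonneg divide_nonneg_pos prod_nonneg)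

lemma bw_0: "bw 0 c = cmod (c (\<lambda>_. 0))"
  by (simp add: bw_def monoms_0)

lemma prod_fact_upd_Suc:
  "(\<Prod>i\<in>UNIV. fact ((b(j := Suc (b j))) i) :: real) = of_nat (Suc (b j)) * (\<Prod>i\<in>UNIV. fact (b (i::'n::finite)))"
  by (subst (1 2) prod.remove[of UNIV j]) (auto intro!: prod.cong simp: algebra_simps)

lemma norm_vec_power2: "(norm (v::complex^'n::finite))\<^sup>2 = (\<Sum>j\<in>UNIV. (cmod (v$j))\<^sup>2)"
  by (simp add: norm_vec_def L2_set_def sum_nonneg)

text \<open>The Bombieri--Weyl norm makes the normalised derivative \<open>dirder v / (k + 1)\<close>
  a contraction for unit vectors \<open>v\<close>; iterating this yields all the higher derivative estimates.\<close>
lemma bw_dirder_le: "bw k (dirder v c) \<le> real (Suc k) * norm v * bw (Suc k) c"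
proof -
  have CS: "(cmod (dirder v c b))\<^sup>2
      \<le> (norm v)\<^sup>2 * (\<Sum>j\<in>UNIV. (real (Suc (b j)) * cmod (c (b(j := Suc (b j)))))\<^sup>2)" for b
  proof -
    have "cmod (dirder v c b) \<le> (\<Sum>j\<in>UNIV. cmod (v$j) * (real (Suc (b j)) * cmod (c (b(j := Suc (b j))))))"
      unfolding dirder_def
      by (rule order.trans[OF norm_sum]) (simp add: norm_mult mult.assoc del: of_nat_Suc)
    then have "(cmod (dirder v c b))\<^sup>2
      \<le> (\<Sum>j\<in>UNIV. cmod (v$j) * (real (Suc (b j)) * cmod (c (b(j := Suc (b j))))))\<^sup>2"
      by (intro power_mono) auto
    also have "\<dots> \<le> (\<Sum>j\<in>UNIV. (cmod (v$j))\<^sup>2) * (\<Sum>j\<in>UNIV. (real (Suc (b j)) * cmod (c (b(j := Suc (b j)))))\<^sup>2)"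
      by (rule Cauchy_Schwarz_ineq_sum)
    finally show ?thesis by (simp add: norm_vec_power2)
  qed
  \<comment> \<open>The weight divides by \<open>fact k\<close>, although \<open>h\<close> is
    evaluated at monomials of degree \<open>Suc k\<close>. That discrepancy gives one factor
    \<open>Suc k\<close>; the other is the sum of the exponents.\<close>
  define h where "h a = (\<Prod>i\<in>UNIV. fact (a i)) / fact k * (cmod (c a))\<^sup>2" for a
  have "(bw k (dirder v c))\<^sup>2
    \<le> (\<Sum>b\<in>monoms k. (\<Prod>j\<in>UNIV. fact (b j)) / fact k *
         ((norm v)\<^sup>2 * (\<Sum>j\<in>UNIV. (real (Suc (b j)) * cmod (c (b(j := Suc (b j)))))\<^sup>2)))"
    unfolding bw_power2
    by (intro sum_mono mult_left_mono CS divide_nonneg_pos prod_nonneg) auto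
  also have "\<dots> = (norm v)\<^sup>2 * (\<Sum>b\<in>monoms k. \<Sum>j\<in>UNIV. real (Suc (b j)) * h (b(j := Suc (b j))))"
    unfolding h_def prod_fact_upd_Suc sum_distrib_left
    by (intro sum.cong refl) (simp add: power2_eq_square field_simps)
  also have "\<dots> = (norm v)\<^sup>2 * (\<Sum>a\<in>monoms (Suc k). \<Sum>j\<in>UNIV. real (a j) * h a)"
    by (subst (1 2) sum.swap, subst sum_monoms_Suc[symmetric]) simp
  also have "(\<Sum>a\<in>monoms (Suc k). \<Sum>j\<in>UNIV. real (a j) * h a) = (\<Sum>a\<in>monoms (Suc k). real (Suc k) * h a)"
    unfolding sum_distrib_right[symmetric] of_nat_sum[symmetric]
    by (intro sum.cong) (auto simp: monoms_def)
  also have "\<dots> = (real (Suc k))\<^sup>2 * (bw (Suc k) c)\<^sup>2"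
    unfolding bw_power2 h_def sum_distrib_left
    by (intro sum.cong) (auto simp: power2_eq_square divide_simps simp del: of_nat_Suc)
  finally have "(bw k (dirder v c))\<^sup>2 \<le> (real (Suc k) * norm v * bw (Suc k) c)\<^sup>2"
    by (simp add: power_mult_distrib mult_ac)
  then show ?thesis
    by (rule power2_le_imp_le) simp
qed

lemma prod_power_upd_Suc:
  fixes x :: "complex^'n::finite"
  shows "(\<Prod>k\<in>UNIV. if k = j then (x$k) ^ ((b(j := Suc (b j))) k - 1) else (x$k) ^ ((b(j := Suc (b j))) k))
    = (\<Prod>k\<in>UNIV. (x$k) ^ (b k))"
  by (intro prod.cong) auto

text \<open>The index shift turns \<open>Suc (b j)\<close> into the exponent that differentiation
  brings down. The right side is a row of \<open>Jac\<close> applied to \<open>w\<close>.\<close>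

lemma hev_dirder:
  "hev k (dirder w c) x = (\<Sum>j\<in>UNIV. (\<Sum>a\<in>monoms (Suc k). c a * of_nat (a j) *
      (\<Prod>l\<in>UNIV. if l = j then (x$l) ^ (a l - 1) else (x$l) ^ (a l))) * w$j)"
proof -
  define h where "h j a = c a * (\<Prod>l\<in>UNIV. if l = j then (x$l) ^ (a l - 1) else (x$l) ^ (a l))" for j a
  have "hev k (dirder w c) x = (\<Sum>b\<in>monoms k. \<Sum>j\<in>UNIV. w$j * (of_nat (Suc (b j)) * h j (b(j := Suc (b j)))))"
    unfolding hev_def dirder_def h_def prod_power_upd_Suc sum_distrib_right
    by (intro sum.cong) (auto simp: algebra_simps)
  also have "\<dots> = (\<Sum>j\<in>UNIV. w$j * (\<Sum>b\<in>monoms k. of_nat (Suc (b j)) * h j (b(j := Suc (b j)))))"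
    by (subst sum.swap) (simp add: sum_distrib_left)
  also have "\<dots> = (\<Sum>j\<in>UNIV. w$j * (\<Sum>a\<in>monoms (Suc k). of_nat (a j) * h j a))"
    by (subst sum_monoms_Suc) simp
  finally show ?thesis
    unfolding h_def by (simp add: mult_ac)
qed

lemma Jac_mult_nth:
  assumes "d i \<ge> 1"
  shows "(Jac d f x *v w) $ i = hev (d i - 1) (dirder w (f i)) x"
proof -
  have "Suc (d i - 1) = d i" using assms by simp
  then show ?thesis
    by (simp add: hev_dirder Jac_def matrix_vector_mult_def)
qed

lemma hev_Euler: "hev k (dirder x c) x = of_nat (Suc k) * hev (Suc k) c x"
proof -
  have *: "of_nat (a j) * ((\<Prod>l\<in>UNIV. if l = j then (x$l) ^ (a l - 1) else (x$l) ^ (a l)) * x$j)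
      = of_nat (a j) * (\<Prod>l\<in>UNIV. (x$l) ^ (a l))" for a j
  proof (cases "a j")
    case (Suc m)
    have "(\<Prod>l\<in>UNIV - {j}. if l = j then (x$l) ^ (a l - 1) else (x$l) ^ (a l)) = (\<Prod>l\<in>UNIV - {j}. (x$l) ^ (a l))"
      by (intro prod.cong) auto
    then show ?thesis
      by (subst (1 2) prod.remove[of UNIV j]) (auto simp: Suc mult_ac)
  qed simp
  have "hev k (dirder x c) x = (\<Sum>j\<in>UNIV. \<Sum>a\<in>monoms (Suc k). c a * (of_nat (a j) * (\<Prod>l\<in>UNIV. (x$l) ^ (a l))))"
    unfolding hev_dirder sum_distrib_right mult.assoc * ..
  also have "\<dots> = (\<Sum>a\<in>monoms (Suc k). \<Sum>j\<in>UNIV. of_nat (a j) * (c a * (\<Prod>l\<in>UNIV. (x$l) ^ (a l))))"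
    by (subst sum.swap) (simp add: mult_ac)
  also have "\<dots> = (\<Sum>a\<in>monoms (Suc k). of_nat (Suc k) * (c a * (\<Prod>l\<in>UNIV. (x$l) ^ (a l))))"
    unfolding sum_distrib_right[symmetric] of_nat_sum[symmetric]
    by (intro sum.cong) (auto simp: monoms_def)
  finally show ?thesis by (simp add: hev_def sum_distrib_left)
qed

text \<open>Euler's identity iterated \<open>k\<close> times reaches degree 0, where only the
  constant coefficient is left. Evaluation at \<open>x\<close> thus becomes an operator power, which
  makes Taylor expansion a binomial theorem.\<close>

lemma hev_eq_funpow: "fact k * hev k c x = (dirder x ^^ k) c (\<lambda>_. 0)"
proof (induction k arbitrary: c)
  case 0
  then show ?case by (simp add: hev_def monoms_0)
next
  case (Suc k)
  have "fact (Suc k) * hev (Suc k) c x = fact k * hev k (dirder x c) x"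
    by (simp add: hev_Euler algebra_simps)
  then show ?case by (simp add: Suc funpow_swap1)
qed

text \<open>Each derivative costs its current degree times the norm of its direction; the degrees
  multiply up to the factorial.\<close>

lemma cmod_funpow_dirder_le:
  fixes c :: "('n::finite \<Rightarrow> nat) \<Rightarrow> complex"
  shows "cmod ((dirder u ^^ k) ((dirder x ^^ l) c) (\<lambda>_. 0)) \<le> fact (k + l) * norm u ^ k * norm x ^ l * bw (k + l) c"
proof -
  have 1: "bw m ((dirder v ^^ k) c) * fact m \<le> fact (m + k) * norm v ^ k * bw (m + k) c"
    for m k :: nat and v and c :: "('n \<Rightarrow> nat) \<Rightarrow> complex"
  proof (induction k arbitrary: m)
    case (Suc k)
    have "bw m ((dirder v ^^ Suc k) c) * fact m \<le> (real (Suc m) * norm v * bw (Suc m) ((dirder v ^^ k) c)) * fact m"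
      by (intro mult_right_mono) (auto intro: bw_dirder_le simp del: of_nat_Suc)
    also have "\<dots> = norm v * (bw (Suc m) ((dirder v ^^ k) c) * fact (Suc m))"
      by (simp add: algebra_simps)
    also have "\<dots> \<le> norm v * (fact (Suc m + k) * norm v ^ k * bw (Suc m + k) c)"
      by (intro mult_left_mono Suc) auto
    finally show ?case by (simp add: algebra_simps)
  qed simp
  have "cmod ((dirder u ^^ k) ((dirder x ^^ l) c) (\<lambda>_. 0)) \<le> norm u ^ k * (bw k ((dirder x ^^ l) c) * fact k)"
    using 1[where m = 0 and v = u and k = k and c = "(dirder x ^^ l) c"] by (simp add: bw_0 mult_ac)
  also have "\<dots> \<le> norm u ^ k * (fact (k + l) * norm x ^ l * bw (k + l) c)"
    by (intro mult_left_mono 1) auto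
  finally show ?thesis by (simp add: mult_ac)
qed

section \<open>Taylor expansion as a binomial theorem for commuting derivatives\<close>

lemma dirder_commute: "dirder v (dirder w c) = dirder w (dirder v c)"
proof
  fix b
  have *: "v$i * of_nat (Suc (b i)) * (w$j * of_nat (Suc ((b(i := Suc (b i))) j)) *
        c (b(i := Suc (b i), j := Suc ((b(i := Suc (b i))) j)))) =
      w$j * of_nat (Suc (b j)) * (v$i * of_nat (Suc ((b(j := Suc (b j))) i)) *
        c (b(j := Suc (b j), i := Suc ((b(j := Suc (b j))) i))))" for i j
    by (cases "i = j") (auto simp: fun_upd_twist mult_ac)
  show "dirder v (dirder w c) b = dirder w (dirder v c) b"
    unfolding dirder_def sum_distrib_left
    by (subst sum.swap) (intro sum.cong refl *)
qed

lemma funpow_dirder_commute: "(dirder v ^^ k) (dirder w c) = dirder w ((dirder v ^^ k) c)"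
  by (induction k) (simp_all add: dirder_commute)

lemma dirder_add_left: "dirder (v + w) c = (\<lambda>b. dirder v c b + dirder w c b)"
  by (auto simp: dirder_def algebra_simps sum.distrib)

lemma dirder_add_right: "dirder v (\<lambda>b. c b + e b) = (\<lambda>b. dirder v c b + dirder v e b)"
  by (rule ext) (simp add: dirder_def distrib_left sum.distrib)

lemma funpow_dirder_add_right: "(dirder v ^^ k) (\<lambda>b. c b + e b) = (\<lambda>b. (dirder v ^^ k) c b + (dirder v ^^ k) e b)"
  by (induction k) (simp_all add: dirder_add_right)

text \<open>Pascal's rule with an arbitrary array in place of products of powers, so that it applies
  to iterated operators.\<close>

lemma pascal_sum:
  fixes A :: "nat \<Rightarrow> nat \<Rightarrow> complex"
  shows "(\<Sum>k\<le>m. of_nat (m choose k) * (A (Suc k) (m - k) + A k (Suc (m - k))))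
    = (\<Sum>k\<le>Suc m. of_nat (Suc m choose k) * A k (Suc m - k))"
proof -
  have *: "(\<Sum>k\<le>m. of_nat (m choose k) * A k (Suc (m - k))) =
      A 0 (Suc m) + (\<Sum>k\<le>m. of_nat (m choose Suc k) * A (Suc k) (m - k))"
  proof -
    have "(\<Sum>k\<le>m. of_nat (m choose k) * A k (Suc (m - k))) = (\<Sum>k\<le>m. of_nat (m choose k) * A k (Suc m - k))"
      by (intro sum.cong) (auto simp: Suc_diff_le)
    also have "\<dots> = (\<Sum>k\<le>Suc m. of_nat (m choose k) * A k (Suc m - k))"
      by (simp add: binomial_eq_0)
    finally show ?thesis by (simp add: sum.atMost_Suc_shift del: sum.atMost_Suc)
  qed
  show ?thesis
    by (simp add: sum.atMost_Suc_shift * distrib_left distrib_right sum.distrib del: sum.atMost_Suc)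
qed

lemma funpow_dirder_binomial:
  "(dirder (x + u) ^^ m) c b = (\<Sum>k\<le>m. of_nat (m choose k) * (dirder u ^^ k) ((dirder x ^^ (m - k)) c) b)"
proof (induction m arbitrary: c)
  case (Suc m)
  have "(dirder (x + u) ^^ Suc m) c b = (dirder (x + u) ^^ m) (dirder (x + u) c) b"
    by (simp add: funpow_swap1)
  also have "\<dots> = (\<Sum>k\<le>m. of_nat (m choose k) * ((dirder u ^^ Suc k) ((dirder x ^^ (m - k)) c) b
      + (dirder u ^^ k) ((dirder x ^^ Suc (m - k)) c) b))"
    unfolding Suc dirder_add_left funpow_dirder_add_right sum.distrib distrib_left
    by (simp add: funpow_dirder_commute add.commute)
  finally show ?case
    unfolding pascal_sum[where A = "\<lambda>k l. (dirder u ^^ k) ((dirder x ^^ l) c) b"] .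
qed simp

text \<open>The part of \<open>hev m c (x + u)\<close> of degree \<open>k\<close> in
  \<open>u\<close>; \<open>fact m\<close> is the factor from \<open>hev_eq_funpow\<close>.\<close>

definition taylor_term :: "nat \<Rightarrow> (('n::finite \<Rightarrow> nat) \<Rightarrow> complex) \<Rightarrow> complex^'n \<Rightarrow> complex^'n \<Rightarrow> nat \<Rightarrow> complex" where
  "taylor_term m c x u k = of_nat (m choose k) * (dirder u ^^ k) ((dirder x ^^ (m - k)) c) (\<lambda>_. 0) / fact m"

lemma hev_add: "hev m c (x + u) = (\<Sum>k\<le>m. taylor_term m c x u k)"
proof -
  have "fact m * hev m c (x + u) = (\<Sum>k\<le>m. of_nat (m choose k) * (dirder u ^^ k) ((dirder x ^^ (m - k)) c) (\<lambda>_. 0))"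
    by (simp add: hev_eq_funpow funpow_dirder_binomial)
  then show ?thesis
    by (simp add: taylor_term_def sum_divide_distrib[symmetric] field_simps)
qed

lemma taylor_term_0: "taylor_term m c x u 0 = hev m c x"
  using hev_eq_funpow[of m c x] by (simp add: taylor_term_def field_simps)

lemma taylor_term_1: "taylor_term (Suc m) c x u 1 = hev m (dirder u c) x"
  using hev_eq_funpow[of m "dirder u c" x]
  by (simp add: taylor_term_def divide_simps funpow_dirder_commute del: of_nat_Suc) (simp add: mult_ac)

text \<open>The factorial cancels and leaves the corresponding term in the binomial expansion of
  \<open>(norm u + norm x) ^ m\<close>. So \<open>bw m c\<close> times the \<open>m\<close>-th power
  majorises the polynomial.\<close>

lemma cmod_taylor_term_le:
  assumes "k \<le> m"
  shows "cmod (taylor_term m c x u k) \<le> bw m c * (real (m choose k) * norm u ^ k * norm x ^ (m - k))"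
proof -
  have "cmod (taylor_term m c x u k)
      = real (m choose k) * cmod ((dirder u ^^ k) ((dirder x ^^ (m - k)) c) (\<lambda>_. 0)) / fact m"
    by (simp add: taylor_term_def norm_mult norm_divide)
  also have "\<dots> \<le> real (m choose k) * (fact (k + (m - k)) * norm u ^ k * norm x ^ (m - k) * bw (k + (m - k)) c) / fact m"
    by (intro divide_right_mono mult_left_mono cmod_funpow_dirder_le) auto
  finally show ?thesis using assms by (simp add: mult_ac)
qed

lemma cmod_hev_le: "cmod (hev m c x) \<le> bw m c * norm x ^ m"
  using cmod_taylor_term_le[of 0 m c x 0] by (simp add: taylor_term_0)

lemma cmod_hev_diff_le:
  "cmod (hev m c (x + u) - hev m c x) \<le> bw m c * ((norm x + norm u) ^ m - norm x ^ m)"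
proof -
  have split: "{..m} = insert 0 {1..m}" by auto
  have "hev m c (x + u) - hev m c x = (\<Sum>k=1..m. taylor_term m c x u k)"
    unfolding hev_add split by (simp add: taylor_term_0)
  then have "cmod (hev m c (x + u) - hev m c x) \<le> (\<Sum>k=1..m. bw m c * (real (m choose k) * norm u ^ k * norm x ^ (m - k)))"
    by (auto intro!: order.trans[OF norm_sum] sum_mono cmod_taylor_term_le)
  also have "\<dots> = bw m c * ((norm u + norm x) ^ m - norm x ^ m)"
    unfolding binomial_ring split by (simp add: sum_distrib_left)
  finally show ?thesis by (simp add: add.commute)
qed

lemma cmod_hev_taylor2_le:
  "cmod (hev (Suc m) c (x + u) - hev (Suc m) c x - hev m (dirder u c) x)
    \<le> bw (Suc m) c * (\<Sum>k=2..Suc m. real (Suc m choose k) * norm u ^ k * norm x ^ (Suc m - k))"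
proof -
  have split: "{..Suc m} = insert 0 (insert 1 {2..Suc m})" by auto
  have "hev (Suc m) c (x + u) - hev (Suc m) c x - hev m (dirder u c) x = (\<Sum>k=2..Suc m. taylor_term (Suc m) c x u k)"
    unfolding hev_add split by (simp add: taylor_term_0 taylor_term_1[unfolded One_nat_def])
  also have "cmod \<dots> \<le> (\<Sum>k=2..Suc m. bw (Suc m) c * (real (Suc m choose k) * norm u ^ k * norm x ^ (Suc m - k)))"
    by (rule order.trans[OF norm_sum], rule sum_mono, rule cmod_taylor_term_le) simp
  finally show ?thesis by (simp only: sum_distrib_left)
qed

subsection \<open>Hermitian geometry\<close>

lemma hinner_add_left: "hinner (x + y) z = hinner x z + hinner y z"
  by (simp add: hinner_def distrib_right sum.distrib)

lemma hinner_add_right: "hinner z (x + y) = hinner z x + hinner z y"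
  by (simp add: hinner_def distrib_left sum.distrib)

lemma hinner_diff_left: "hinner (x - y) z = hinner x z - hinner y z"
  by (simp add: hinner_def left_diff_distrib sum_subtractf)

lemma hinner_minus_left: "hinner (- x) z = - hinner x z"
  by (simp add: hinner_def sum_negf)

lemma hinner_smult_left: "hinner (c *s x) y = c * hinner x y"
  by (simp add: hinner_def sum_distrib_left mult_ac)

lemma hinner_smult_right: "hinner x (c *s y) = cnj c * hinner x y"
  by (simp add: hinner_def sum_distrib_left mult_ac)

lemma hinner_commute: "hinner x y = cnj (hinner y x)"
  by (simp add: hinner_def mult.commute)

lemma hinner_self: "hinner x x = complex_of_real ((norm x)\<^sup>2)"
  by (simp add: hinner_def norm_vec_def L2_set_def sum_nonneg complex_norm_square del: of_real_power)

lemma Re_hinner: "Re (hinner x y) = inner x y"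
  by (simp add: hinner_def inner_vec_def inner_complex_def)

lemma cmod_hinner_le: "cmod (hinner x y) \<le> norm x * norm y"
proof -
  have "cmod (hinner x y) \<le> (\<Sum>j\<in>UNIV. \<bar>cmod (x$j)\<bar> * \<bar>cmod (y$j)\<bar>)"
    unfolding hinner_def by (rule order.trans[OF norm_sum]) (simp add: norm_mult)
  also have "\<dots> \<le> norm x * norm y"
    unfolding norm_vec_def by (rule L2_set_mult_ineq)
  finally show ?thesis .
qed

lemma norm_smult: "norm (c *s x) = cmod c * norm (x::complex^'n::finite)"
  by (simp add: norm_vec_def norm_mult L2_set_right_distrib)

lemma norm_smult_add_perp:
  assumes "hinner u b = 0"
  shows "(norm (c *s b + u))\<^sup>2 = (cmod c * norm b)\<^sup>2 + (norm u)\<^sup>2"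
proof -
  have "inner (c *s b) u = 0"
    using assms hinner_commute[of b u] by (simp add: Re_hinner[symmetric] hinner_smult_left)
  then show ?thesis
    by (simp add: norm_smult[symmetric] power2_norm_eq_inner algebra_simps inner_commute)
qed

lemma norm_le_add_perp:
  assumes "hinner u b = 0"
  shows "norm b \<le> norm (b + u)"
proof -
  have *: "(norm (b + u))\<^sup>2 = (norm b)\<^sup>2 + (norm u)\<^sup>2"
    using norm_smult_add_perp[OF assms, of 1] by simp
  show "norm b \<le> norm (b + u)" by (rule power2_le_imp_le) (simp_all add: *)
qed

lemma perp_decompose:
  assumes "b \<noteq> 0"
  obtains c u where "a = c *s b + u" "hinner u b = 0" "c = hinner a b / complex_of_real ((norm b)\<^sup>2)"
proof -
  define c where "c = hinner a b / complex_of_real ((norm b)\<^sup>2)"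
  have "hinner (a - c *s b) b = 0"
    using assms by (simp add: hinner_diff_left hinner_smult_left hinner_self c_def)
  then show ?thesis
    using that[of c "a - c *s b"] by (simp add: c_def)
qed

lemma dR_commute: "dR a b = dR b a"
proof -
  have "cmod (hinner a b) = cmod (hinner b a)"
    by (subst hinner_commute) simp
  then show ?thesis by (simp add: dR_def mult.commute)
qed

lemma dT_commute: "dT a b = dT b a"
  by (simp add: dT_def dR_commute)

text \<open>A right triangle with legs \<open>c *s b\<close> and \<open>u\<close>: the tangent of
  the angle is the ratio of the legs.\<close>

lemma dT_smult_add_perp:
  assumes b: "b \<noteq> 0" and c: "c \<noteq> 0" and u: "hinner u b = 0"
  shows "dT (c *s b + u) b = ereal (norm u / (cmod c * norm b))"
proof -
  let ?a = "c *s b + u"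
  define A B where "A = norm ?a" and "B = cmod c * norm b"
  have B: "B > 0" using b c by (simp add: B_def)
  have pyth: "A\<^sup>2 = B\<^sup>2 + (norm u)\<^sup>2"
    unfolding A_def B_def by (rule norm_smult_add_perp[OF u])
  then have "B\<^sup>2 \<le> A\<^sup>2" by simp
  then have BA: "B \<le> A" by (rule power2_le_imp_le) (simp add: A_def)
  have "hinner ?a b = c * complex_of_real ((norm b)\<^sup>2)"
    by (simp add: hinner_add_left hinner_smult_left hinner_self u)
  then have "cmod (hinner ?a b) = B * norm b"
    by (simp add: norm_mult norm_power B_def power2_eq_square)
  then have dR: "dR ?a b = arccos (B / A)"
    using b by (simp add: dR_def A_def)
  have r: "0 < B / A" "B / A \<le> 1" using B BA by auto
  have "dR ?a b \<noteq> pi / 2"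
  proof
    assume "dR ?a b = pi / 2"
    then have "cos (arccos (B / A)) = 0" by (metis dR cos_pi_half)
    then show False using r by auto
  qed
  moreover have "tan (dR ?a b) = norm u / B"
  proof -
    have "1 - (B / A)\<^sup>2 = (norm u / A)\<^sup>2"
      using B BA pyth by (simp add: power_divide field_simps)
    then have "sin (arccos (B / A)) = norm u / A"
      using r by (simp add: sin_arccos A_def)
    moreover have "cos (arccos (B / A)) = B / A" using r by simp
    ultimately show ?thesis using B BA by (simp add: tan_def dR)
  qed
  ultimately show ?thesis by (simp add: dT_def B_def)
qed

text \<open>Rescaling moves \<open>a\<close> into the chart \<open>b + perp b\<close>, where
  \<open>dT\<close> is Euclidean length relative to \<open>norm b\<close>. Vanishing of
  \<open>peval\<close> and \<open>cond_le\<close> both survive the rescaling.\<close>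

lemma dT_finite_cases:
  assumes "b \<noteq> 0" "dT a b \<noteq> \<infinity>"
  obtains c u where "c \<noteq> 0" "c *s a = b + u" "hinner u b = 0" "dT a b = ereal (norm u / norm b)"
proof -
  obtain e w where ew: "a = e *s b + w" "hinner w b = 0" "e = hinner a b / complex_of_real ((norm b)\<^sup>2)"
    using perp_decompose[OF assms(1)] by blast
  have "e \<noteq> 0"
  proof
    assume "e = 0"
    then have "hinner a b = 0" using ew(3) assms(1) by simp
    then show False using assms(2) by (simp add: dT_def dR_def)
  qed
  define c where "c = inverse e"
  have "c \<noteq> 0" "c *s a = b + c *s w" "hinner (c *s w) b = 0"
    using \<open>e \<noteq> 0\<close> ew(2) by (auto simp: c_def ew(1) hinner_smult_left vec_eq_iff field_simps)
  moreover have "dT a b = ereal (norm (c *s w) / norm b)"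
    using dT_smult_add_perp[OF assms(1) \<open>e \<noteq> 0\<close> ew(2)]
    by (simp add: ew(1) norm_smult c_def norm_inverse divide_inverse mult_ac)
  ultimately show ?thesis using that by blast
qed

lemma dT_smult_left:
  assumes "c \<noteq> 0"
  shows "dT (c *s a) b = dT a b"
  using assms by (simp add: dT_def dR_def hinner_smult_left norm_smult norm_mult)

text \<open>A segment in an affine hyperplane at distance \<open>norm x\<close> from the origin subtends an angle
  \<open>\<theta>\<close> with \<open>tan (\<theta>/2) \<le> L/2\<close>, where \<open>L\<close> is its length relative to \<open>norm x\<close>.\<close>
lemma dR_le_dist:
  fixes x :: "complex^'n::finite"
  assumes x: "x \<noteq> 0" and a: "hinner a x = 0" and b: "hinner b x = 0"
  shows "dR (x + a) (x + b) \<le> norm (a - b) / norm x"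
proof -
  define X Y Z where "X = norm x" and "Y = norm (x + a)" and "Z = norm (x + b)"
  define L P where "L = norm (a - b)" and "P = inner (x + a) (x + b)"
  have X: "X > 0" using x by (simp add: X_def)
  have XY: "X \<le> Y" "X \<le> Z"
    unfolding X_def Y_def Z_def using norm_le_add_perp[OF a] norm_le_add_perp[OF b] by auto
  have Y2: "Y\<^sup>2 = X\<^sup>2 + (norm a)\<^sup>2" and Z2: "Z\<^sup>2 = X\<^sup>2 + (norm b)\<^sup>2"
    unfolding X_def Y_def Z_def
    using norm_smult_add_perp[OF a, of 1] norm_smult_add_perp[OF b, of 1] by auto
  have ax: "inner a x = 0" and bx: "inner x b = 0"
    using a b Re_hinner[of a x] Re_hinner[of b x] by (auto simp: inner_commute)
  have P: "P = X\<^sup>2 + inner a b"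
    by (simp add: P_def X_def inner_add_left inner_add_right ax bx power2_norm_eq_inner)
  have L2: "L\<^sup>2 = Y\<^sup>2 + Z\<^sup>2 - 2 * P"
    unfolding Y2 Z2 P L_def X_def
    by (simp add: power2_norm_eq_inner inner_diff_left inner_diff_right inner_commute algebra_simps)
  \<comment> \<open>Cauchy-Schwarz for the plane vectors \<open>(X, norm a)\<close> and
    \<open>(X, norm b)\<close>.\<close>
  have "X\<^sup>2 + norm a * norm b \<le> Y * Z"
  proof (rule power2_le_imp_le)
    have "2 * (norm a * norm b) \<le> (norm a)\<^sup>2 + (norm b)\<^sup>2"
      using sum_squares_bound[of "norm a" "norm b"] by simp
    then have "X\<^sup>2 * (2 * (norm a * norm b)) \<le> X\<^sup>2 * ((norm a)\<^sup>2 + (norm b)\<^sup>2)"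
      by (intro mult_left_mono) auto
    then show "(X\<^sup>2 + norm a * norm b)\<^sup>2 \<le> (Y * Z)\<^sup>2"
      unfolding power_mult_distrib Y2 Z2 by (simp add: power2_eq_square algebra_simps)
  qed (use X XY in auto)
  moreover have "- (norm a * norm b) \<le> inner a b"
    using Cauchy_Schwarz_ineq2[of a b] by linarith
  ultimately have YZP: "2 * X\<^sup>2 \<le> Y * Z + P" using P by linarith
  have "2 * (Y * Z - P) \<le> L\<^sup>2"
    unfolding L2 using sum_squares_bound[of Y Z] by simp
  \<comment> \<open>The claimed bound for the tangent of the half angle, by
    \<open>tan(\<theta>/2)^2 = (1 - cos \<theta>) / (1 + cos \<theta>)\<close> with cosine
    \<open>P / (Y * Z)\<close>.\<close>
  define h where "h = L / X / 2"
  have YZ: "Y * Z > 0" using X XY by simp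
  have "Y * Z - P \<le> h\<^sup>2 * (Y * Z + P)"
  proof -
    have "2 * X\<^sup>2 * (2 * (Y * Z - P)) \<le> 2 * X\<^sup>2 * L\<^sup>2"
      using \<open>2 * (Y * Z - P) \<le> L\<^sup>2\<close> by (intro mult_left_mono) auto
    also have "\<dots> \<le> L\<^sup>2 * (Y * Z + P)"
      using mult_left_mono[OF YZP, of "L\<^sup>2"] by (simp add: mult_ac)
    finally show ?thesis
      using X by (simp add: h_def power_divide field_simps)
  qed
  then have "(1 - h\<^sup>2) * (Y * Z) \<le> P * (1 + h\<^sup>2)"
    by (simp add: algebra_simps)
  moreover have "0 < 1 + h\<^sup>2" by (simp add: add_pos_nonneg)
  ultimately have *: "(1 - h\<^sup>2) / (1 + h\<^sup>2) \<le> P / (Y * Z)"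
    using YZ by (simp add: divide_le_eq le_divide_eq mult_ac)
  \<comment> \<open>\<open>dR\<close> uses the modulus of the Hermitian product instead of its real
    part \<open>P\<close>, which can only make the angle smaller.\<close>
  define q where "q = cmod (hinner (x + a) (x + b)) / (Y * Z)"
  have "P / (Y * Z) \<le> q"
    unfolding q_def P_def Re_hinner[symmetric] using YZ
    by (intro divide_right_mono complex_Re_le_cmod) auto
  with * have q: "cos (2 * arctan h) \<le> q"
    using cos_tan_half[of "arctan h"] by (simp add: tan_arctan)
  have "q \<le> 1"
    unfolding q_def Y_def Z_def using cmod_hinner_le[of "x + a" "x + b"] YZ
    by (simp add: divide_le_eq Y_def Z_def)
  have "h \<ge> 0" using X by (simp add: h_def L_def)
  have "arccos q \<le> arccos (cos (2 * arctan h))"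
    using q \<open>q \<le> 1\<close> by (intro arccos_le_arccos) auto
  also have "\<dots> = 2 * arctan h"
    using \<open>h \<ge> 0\<close> arctan_ubound[of h] by (intro arccos_cos) auto
  also have "\<dots> \<le> 2 * h"
    using arctan_le_self[OF \<open>h \<ge> 0\<close>] by simp
  finally show ?thesis
    by (simp add: dR_def q_def Y_def Z_def h_def L_def X_def)
qed

text \<open>Split \<open>a - b\<close> along \<open>z + b\<close>, which is at least as long as
  \<open>z\<close>. Relative to \<open>norm (z + b)\<close>, the orthogonal leg is at most
  \<open>s\<close> and the parallel leg of \<open>z + a\<close> at least
  \<open>1 - s\<close>.\<close>

lemma dT_le_of_dist:
  assumes z: "z \<noteq> 0" and a: "hinner a z = 0" and b: "hinner b z = 0"
    and s: "norm (a - b) \<le> s * norm z" "s < 1"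
  shows "z + a \<noteq> 0" "dT (z + a) (z + b) \<le> ereal (s / (1 - s))"
proof -
  have n: "norm z > 0" using z by simp
  have n': "norm z \<le> norm (z + b)" by (rule norm_le_add_perp[OF b])
  show "z + a \<noteq> 0" using norm_le_add_perp[OF a] n by auto
  have bz: "z + b \<noteq> 0" using n n' by auto
  then obtain c u where cu: "a - b = c *s (z + b) + u" "hinner u (z + b) = 0"
    using perp_decompose[of "z + b" "a - b"] by blast
  have eq: "z + a = (1 + c) *s (z + b) + u"
    using cu(1) by (simp add: vec_eq_iff algebra_simps)
  have s0: "s \<ge> 0" using s(1) n norm_ge_zero[of "a - b"] by (metis order.trans zero_le_mult_iff not_less)
  have sq: "(norm (a - b))\<^sup>2 = (cmod c * norm (z + b))\<^sup>2 + (norm u)\<^sup>2"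
    unfolding cu(1) by (rule norm_smult_add_perp[OF cu(2)])
  have "norm u \<le> norm (a - b)" "cmod c * norm (z + b) \<le> norm (a - b)"
    by (rule power2_le_imp_le, use sq in auto)+
  then have u: "norm u \<le> s * norm (z + b)" and c: "cmod c * norm (z + b) \<le> s * norm (z + b)"
    using s(1) mult_left_mono[OF n' s0] by linarith+
  from c have "cmod c \<le> s" using bz by simp
  then have c1: "1 - s \<le> cmod (1 + c)"
    using norm_triangle_ineq2[of 1 "- c"] by simp
  then have "1 + c \<noteq> 0" using s(2) by auto
  have "norm u / (cmod (1 + c) * norm (z + b)) \<le> (s * norm (z + b)) / ((1 - s) * norm (z + b))"
    using u c1 s(2) bz s0 by (intro frac_le mult_right_mono mult_pos_pos) auto
  also have "\<dots> = s / (1 - s)" using bz by simp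
  finally show "dT (z + a) (z + b) \<le> ereal (s / (1 - s))"
    unfolding eq dT_smult_add_perp[OF bz \<open>1 + c \<noteq> 0\<close> cu(2)] by simp
qed

subsection \<open>The condition number as a lower bound\<close>

lemma linear_mult_hinner:
  fixes A :: "complex^'n::finite^'m::finite"
  shows "linear (\<lambda>v. (A *v v, hinner v z))"
  by (auto simp: linear_iff matrix_vector_mult_def hinner_def vec_eq_iff scaleR_sum_right
      sum.distrib distrib_left distrib_right)

text \<open>Adjoining the coordinate \<open>hinner v z\<close> gives a real-linear map between
  spaces of equal dimension, so injectivity yields surjectivity. Preimages of \<open>(w, 0)\<close>
  lie in \<open>perp z\<close>.\<close>

lemma bij_betw_perpI:
  fixes A :: "complex^'n::finite^'m::finite"
  assumes dims: "CARD('n) = CARD('m) + 1" and z: "z \<noteq> 0"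
    and inj: "\<And>v. v \<in> perp z \<Longrightarrow> A *v v = 0 \<Longrightarrow> v = 0"
  shows "bij_betw (\<lambda>v. A *v v) (perp z) UNIV"
proof -
  define g where "g v = (A *v v, hinner v z)" for v
  have lin: "linear g"
    unfolding g_def by (rule linear_mult_hinner)
  have "inj g"
    unfolding linear_injective_0[OF lin] using inj by (auto simp: g_def perp_def zero_prod_def)
  moreover have "dim (UNIV :: ((complex^'m) \<times> complex) set) = dim (UNIV :: (complex^'n) set)"
    using dims by simp
  ultimately have surj: "surj g"
    using linear_injective_imp_surjective[OF lin] by blast
  have "inj_on (\<lambda>v. A *v v) (perp z)"
  proof (rule inj_onI)
    fix v w assume "v \<in> perp z" "w \<in> perp z" "A *v v = A *v w"
    then have "g v = g w" by (simp add: g_def perp_def)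
    then show "v = w" using \<open>inj g\<close> by (simp add: inj_eq)
  qed
  moreover have "w \<in> (\<lambda>v. A *v v) ` perp z" for w
  proof -
    obtain v where "g v = (w, 0)" using surj by (metis surj_def)
    then show ?thesis by (auto simp: g_def perp_def)
  qed
  ultimately show ?thesis by (auto simp: bij_betw_def)
qed

lemma bij_betw_perp_of_surj:
  fixes A :: "complex^'n::finite^'m::finite"
  assumes dims: "CARD('n) = CARD('m) + 1" and z: "z \<noteq> 0"
    and surj: "(\<lambda>v. A *v v) ` perp z = UNIV"
  shows "bij_betw (\<lambda>v. A *v v) (perp z) UNIV"
proof -
  define g where "g v = (A *v v, hinner v z)" for v
  have lin: "linear g"
    unfolding g_def by (rule linear_mult_hinner)
  have "\<exists>v. (w, e) = g v" for w e
  proof -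
    \<comment> \<open>The multiple of \<open>z\<close> whose product with \<open>z\<close> is
      \<open>e\<close>; \<open>v\<close> then compensates for its image under
      \<open>A\<close>.\<close>
    define c where "c = e / complex_of_real ((norm z)\<^sup>2)"
    obtain v where v: "v \<in> perp z" "A *v v = w - A *v (c *s z)"
      using surj by (metis UNIV_I imageE)
    have "g (v + c *s z) = (w, e)"
      using v z by (simp add: g_def matrix_vector_right_distrib hinner_add_left perp_def
          hinner_smult_left hinner_self c_def)
    then show ?thesis by metis
  qed
  then have "surj g" by (metis surj_def surj_pair)
  moreover have "dim (UNIV :: ((complex^'m) \<times> complex) set) = dim (UNIV :: (complex^'n) set)"
    using dims by simp
  ultimately have "inj g"
    using linear_surjective_imp_injective[OF lin] by blast
  then have inj: "v = 0" if "v \<in> perp z" "A *v v = 0" for v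
    using that unfolding linear_injective_0[OF lin] by (auto simp: g_def perp_def zero_prod_def)
  show ?thesis
    by (rule bij_betw_perpI[OF dims z inj])
qed

lemma RInv_solves:
  assumes "bij_betw (\<lambda>v. Jac d f x *v v) (perp x) UNIV"
  shows "RInv d f x w \<in> perp x" "Jac d f x *v RInv d f x w = w"
proof -
  have "w \<in> (\<lambda>v. Jac d f x *v v) ` perp x"
    using assms by (simp add: bij_betw_def)
  then have "\<exists>!v. v \<in> perp x \<and> Jac d f x *v v = w"
    using bij_betw_imp_inj_on[OF assms] by (auto dest: inj_onD)
  from theI'[OF this] show "RInv d f x w \<in> perp x" "Jac d f x *v RInv d f x w = w"
    unfolding RInv_def by auto
qed

lemma RInv_unique:
  assumes "bij_betw (\<lambda>v. Jac d f x *v v) (perp x) UNIV"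
    and "v \<in> perp x" "Jac d f x *v v = w"
  shows "RInv d f x w = v"
  using inj_onD[OF bij_betw_imp_inj_on[OF assms(1)], of "RInv d f x w" v] RInv_solves[OF assms(1), of w] assms(2,3)
  by simp

lemma perp_add: "v \<in> perp x \<Longrightarrow> w \<in> perp x \<Longrightarrow> v + w \<in> perp x"
  and perp_diff: "v \<in> perp x \<Longrightarrow> w \<in> perp x \<Longrightarrow> v - w \<in> perp x"
  and perp_minus: "v \<in> perp x \<Longrightarrow> - v \<in> perp x"
  by (auto simp: perp_def hinner_add_left hinner_diff_left hinner_minus_left)

lemma perp_scaleR: "v \<in> perp x \<Longrightarrow> r *\<^sub>R v \<in> perp x"
  by (simp add: perp_def hinner_def scaleR_sum_right[symmetric])

lemma mat_vec_scaleR: "A *v (r *\<^sub>R v) = r *\<^sub>R (A *v (v::complex^'n::finite))"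
  by (simp add: vec_eq_iff matrix_vector_mult_def scaleR_sum_right)

lemma linear_RInv:
  assumes "bij_betw (\<lambda>v. Jac d f x *v v) (perp x) UNIV"
  shows "linear (RInv d f x)"
  unfolding linear_iff
  by (auto intro!: RInv_unique[OF assms] perp_add perp_scaleR
      simp: RInv_solves[OF assms] matrix_vector_right_distrib mat_vec_scaleR)

text \<open>The inverse of the diagonal weight in \<open>mu\<close> when \<open>z\<close> and all
  degrees are nonzero.\<close>

definition scal :: "('m::finite \<Rightarrow> nat) \<Rightarrow> complex^'n::finite \<Rightarrow> complex^'m \<Rightarrow> complex^'m" where
  "scal d z w = (\<chi> i. w$i / complex_of_real (sqrt (real (d i)) * norm z ^ (d i - 1)))"

text \<open>\<open>cond_le d f z M\<close> says \<open>mu d f z \<le> M\<close> in a form that mentions no inverse: it entails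
  invertibility on \<open>perp z\<close> and is visibly invariant under scaling of \<open>z\<close>.\<close>
definition cond_le :: "('m::finite \<Rightarrow> nat) \<Rightarrow> ('m \<Rightarrow> ('n::finite \<Rightarrow> nat) \<Rightarrow> complex) \<Rightarrow> complex^'n \<Rightarrow> real \<Rightarrow> bool" where
  "cond_le d f z M \<longleftrightarrow> (\<forall>v\<in>perp z. BWnorm d f * norm v \<le> M * norm (scal d z (Jac d f z *v v)))"

lemma BWnorm_eq_L2: "BWnorm d f = L2_set (\<lambda>i. bw (d i) (f i)) UNIV"
  by (simp add: BWnorm_def L2_set_def bw_power2)

lemma BWnorm_nonneg: "0 \<le> BWnorm d f"
  by (simp add: BWnorm_eq_L2)

lemma BWnorm_pos:
  assumes "in_Hd d f" "f \<noteq> (\<lambda>i a. 0)"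
  shows "BWnorm d f > 0"
proof (rule ccontr)
  assume "\<not> BWnorm d f > 0"
  then have "L2_set (\<lambda>i. bw (d i) (f i)) UNIV = 0"
    using BWnorm_nonneg[of d f] unfolding BWnorm_eq_L2 by linarith
  then have "bw (d i) (f i) = 0" for i
    by (simp add: L2_set_eq_0_iff)
  then have *: "(\<Sum>a\<in>monoms (d i). (\<Prod>j\<in>UNIV. fact (a j)) / fact (d i) * (cmod (f i a))\<^sup>2) = 0" for i
    unfolding bw_power2[symmetric] by simp
  obtain i a where ia: "f i a \<noteq> 0" using assms(2) by blast
  then have a: "a \<in> monoms (d i)" using assms(1) by (auto simp: in_Hd_def monoms_def)
  have "(\<Prod>j\<in>UNIV. fact (a j)) / fact (d i) * (cmod (f i a))\<^sup>2 = 0"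
    using *[of i] a by (subst (asm) sum_nonneg_eq_0_iff)
      (auto intro!: mult_nonneg_nonneg divide_nonneg_pos prod_nonneg)
  then show False using ia by (auto simp: prod_zero_iff)
qed

text \<open>\<open>BWnorm\<close> is the Euclidean norm of the component norms \<open>bw\<close>, so
  estimates proved equation by equation add up without loss.\<close>

lemma norm_le_BWnorm:
  assumes "\<And>i. cmod (w$i) \<le> bw (d i) (f i) * C" "C \<ge> 0"
  shows "norm w \<le> BWnorm d f * C"
proof -
  have "norm w \<le> L2_set (\<lambda>i. bw (d i) (f i) * C) UNIV"
    unfolding norm_vec_def by (rule L2_set_mono) (auto simp: assms)
  also have "\<dots> = BWnorm d f * C"
    using assms(2) by (simp add: BWnorm_eq_L2 L2_set_left_distrib)
  finally show ?thesis .
qed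

lemma peval_nth: "peval d f x $ i = hev (d i) (f i) x"
  by (simp add: peval_def hev_def)

lemma hev_smult: "hev k c (e *s x) = e ^ k * hev k c x"
  unfolding hev_def sum_distrib_left
  by (intro sum.cong refl) (simp add: power_mult_distrib prod.distrib power_sum[symmetric] monoms_def mult_ac)

lemma peval_smult_eq_0: "peval d f x = 0 \<Longrightarrow> peval d f (c *s x) = 0"
  by (simp add: vec_eq_iff peval_nth hev_smult)

text \<open>Row \<open>i\<close> of the Jacobian and the weight in \<open>scal\<close> both scale by
  \<open>cmod c ^ (d i - 1)\<close> in modulus, and \<open>perp\<close> is unchanged.\<close>

lemma cond_le_smult:
  assumes "\<forall>i. d i \<ge> 1" "cond_le d f z M" "c \<noteq> 0"
  shows "cond_le d f (c *s z) M"
proof -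
  have "perp (c *s z) = perp z"
    using assms(3) by (simp add: perp_def hinner_smult_right)
  moreover have "norm (scal d (c *s z) (Jac d f (c *s z) *v v)) = norm (scal d z (Jac d f z *v v))" for v
  proof -
    have "cmod (scal d (c *s z) (Jac d f (c *s z) *v v) $ i) = cmod (scal d z (Jac d f z *v v) $ i)" for i
      using assms(1,3)
      by (simp add: scal_def Jac_mult_nth hev_smult norm_divide norm_mult norm_power
          norm_smult power_mult_distrib)
    then show ?thesis by (simp add: norm_vec_def)
  qed
  ultimately show ?thesis using assms(2) by (simp add: cond_le_def)
qed

lemma cond_le_bij:
  fixes f :: "'m::finite \<Rightarrow> ('n::finite \<Rightarrow> nat) \<Rightarrow> complex"
  assumes "CARD('n) = CARD('m) + 1" "BWnorm d f > 0" "cond_le d f z M" "z \<noteq> 0"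
  shows "bij_betw (\<lambda>v. Jac d f z *v v) (perp z) UNIV"
proof (rule bij_betw_perpI[OF assms(1,4)])
  fix v assume v: "v \<in> perp z" "Jac d f z *v v = 0"
  have "BWnorm d f * norm v \<le> M * norm (scal d z (Jac d f z *v v))"
    using assms(3) v by (auto simp: cond_le_def)
  also have "scal d z (Jac d f z *v v) = 0"
    by (simp add: v scal_def vec_eq_iff)
  finally show "v = 0" using assms(2) by (simp add: mult_le_0_iff)
qed

lemma cond_le_mu:
  fixes d :: "'m::finite \<Rightarrow> nat"
  assumes deg: "\<forall>i. d i \<ge> 1" and x: "x \<noteq> 0"
    and bij: "bij_betw (\<lambda>v. Jac d f x *v v) (perp x) UNIV"
  shows "cond_le d f x (mu d f x)"
  unfolding cond_le_def
proof
  fix v assume v: "v \<in> perp x"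
  define E :: "complex^'m \<Rightarrow> complex^'m"
    where "E w = (\<chi> i. complex_of_real (sqrt (real (d i)) * norm x ^ (d i - 1)) * w$i)" for w
  define R where "R w = RInv d f x (E w)" for w
  have "linear E"
    by (auto simp: linear_iff E_def vec_eq_iff algebra_simps)
  then have "linear R"
    using linear_compose[OF _ linear_RInv[OF bij], of E] by (simp add: R_def[abs_def] comp_def)
  then have "bounded_linear R" by (rule linear_conv_bounded_linear[THEN iffD1])
  then have le: "norm (R w) \<le> onorm R * norm w" for w by (rule onorm)
  let ?w = "scal d x (Jac d f x *v v)"
  have "E ?w = Jac d f x *v v"
  proof -
    have "d i \<noteq> 0" for i using deg by (metis not_one_le_zero)
    then show ?thesis using x by (simp add: E_def scal_def vec_eq_iff)
  qed
  then have "R ?w = v"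
    by (simp add: R_def RInv_unique[OF bij v])
  then have "norm v \<le> onorm R * norm ?w" using le[of ?w] by simp
  then have "BWnorm d f * norm v \<le> BWnorm d f * (onorm R * norm ?w)"
    by (intro mult_left_mono BWnorm_nonneg)
  then show "BWnorm d f * norm v \<le> mu d f x * norm ?w"
    unfolding mu_def R_def[abs_def] E_def by (simp only: mult.assoc)
qed

section \<open>Stability of the condition number\<close>

lemma divide_sqrt_power_le:
  assumes "1 \<le> n" "(n::nat) \<le> D" "0 \<le> B" "0 \<le> t" "0 < X"
  shows "real n * B * t * X / (sqrt (real n) * X) \<le> B * (sqrt (real D) * t)"
proof -
  have "real n = sqrt (real n) * sqrt (real n)" by simp
  then have "real n * B * t * X / (sqrt (real n) * X) = sqrt (real n) * B * t"
    using assms by (simp add: field_simps)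
  also have "\<dots> \<le> sqrt (real D) * B * t"
    using assms by (intro mult_right_mono) auto
  finally show ?thesis by (simp add: mult_ac)
qed

context
  fixes d :: "'m::finite \<Rightarrow> nat" and D :: nat
  assumes deg: "\<And>i. 1 \<le> d i" and degD: "\<And>i. d i \<le> D"
begin

lemma norm_scal_Jac_le:
  assumes p: "p \<noteq> 0"
  shows "norm (scal d p (Jac d f p *v w)) \<le> BWnorm d f * (sqrt (real D) * norm w)"
proof (rule norm_le_BWnorm)
  fix i
  obtain m where m: "d i = Suc m" using deg[of i] by (cases "d i") auto
  have "cmod (hev m (dirder w (f i)) p) \<le> bw m (dirder w (f i)) * norm p ^ m"
    by (rule cmod_hev_le)
  also have "\<dots> \<le> real (Suc m) * norm w * bw (Suc m) (f i) * norm p ^ m"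
    by (intro mult_right_mono bw_dirder_le) auto
  finally have "cmod (hev m (dirder w (f i)) p) / (sqrt (real (Suc m)) * norm p ^ m)
      \<le> real (Suc m) * bw (Suc m) (f i) * norm w * norm p ^ m / (sqrt (real (Suc m)) * norm p ^ m)"
    by (intro divide_right_mono) (auto simp: mult_ac simp del: of_nat_Suc)
  \<comment> \<open>Differentiation contributes the degree, \<open>scal\<close> removes its square
    root, and the remaining root is at most \<open>sqrt (real D)\<close>.\<close>
  also have "\<dots> \<le> bw (Suc m) (f i) * (sqrt (real D) * norm w)"
    using degD[of i] p m by (intro divide_sqrt_power_le) auto
  finally show "cmod (scal d p (Jac d f p *v w) $ i) \<le> bw (d i) (f i) * (sqrt (real D) * norm w)"
    using deg by (simp add: scal_def Jac_mult_nth m norm_divide norm_mult norm_power del: of_nat_Suc)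
qed auto

lemma norm_scal_Jac_diff_le:
  assumes p: "p \<noteq> 0" and u: "norm u \<le> r * norm p"
  shows "norm (scal d p (Jac d f (p + u) *v w - Jac d f p *v w))
    \<le> BWnorm d f * (sqrt (real D) * (norm w * ((1 + r) ^ (D - 1) - 1)))"
proof (rule norm_le_BWnorm)
  have r: "0 \<le> r" using u p norm_ge_zero[of u]
    by (metis order.trans zero_le_mult_iff not_less zero_less_norm_iff)
  then show "0 \<le> sqrt (real D) * (norm w * ((1 + r) ^ (D - 1) - 1))"
    by simp
  fix i
  obtain m where m: "d i = Suc m" using deg[of i] by (cases "d i") auto
  have "cmod (hev m (dirder w (f i)) (p + u) - hev m (dirder w (f i)) p)
      \<le> bw m (dirder w (f i)) * ((norm p + norm u) ^ m - norm p ^ m)"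
    by (rule cmod_hev_diff_le)
  also have "\<dots> \<le> (real (Suc m) * norm w * bw (Suc m) (f i)) * ((norm p + r * norm p) ^ m - norm p ^ m)"
    using u by (intro mult_mono bw_dirder_le diff_right_mono power_mono) (auto simp: power_mono)
  also have "(norm p + r * norm p) ^ m - norm p ^ m = ((1 + r) ^ m - 1) * norm p ^ m"
    by (simp add: algebra_simps power_mult_distrib[symmetric])
  also have "(real (Suc m) * norm w * bw (Suc m) (f i)) * (((1 + r) ^ m - 1) * norm p ^ m)
      \<le> (real (Suc m) * norm w * bw (Suc m) (f i)) * (((1 + r) ^ (D - 1) - 1) * norm p ^ m)"
    using r degD[of i] m by (intro mult_left_mono mult_right_mono diff_right_mono power_increasing) auto
  finally have "cmod (hev m (dirder w (f i)) (p + u) - hev m (dirder w (f i)) p) / (sqrt (real (Suc m)) * norm p ^ m)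
      \<le> real (Suc m) * bw (Suc m) (f i) * (norm w * ((1 + r) ^ (D - 1) - 1)) * norm p ^ m / (sqrt (real (Suc m)) * norm p ^ m)"
    by (intro divide_right_mono) (auto simp: mult_ac simp del: of_nat_Suc)
  also have "\<dots> \<le> bw (Suc m) (f i) * (sqrt (real D) * (norm w * ((1 + r) ^ (D - 1) - 1)))"
    using degD[of i] p m r by (intro divide_sqrt_power_le) auto
  finally show "cmod (scal d p (Jac d f (p + u) *v w - Jac d f p *v w) $ i)
      \<le> bw (d i) (f i) * (sqrt (real D) * (norm w * ((1 + r) ^ (D - 1) - 1)))"
    using deg by (simp add: scal_def Jac_mult_nth m norm_divide norm_mult norm_power del: of_nat_Suc)
qed

lemma norm_scal_antimono:
  assumes "q \<noteq> 0" "norm q \<le> norm p"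
  shows "norm (scal d p w) \<le> norm (scal d q w)"
proof -
  have "cmod (scal d p w $ i) \<le> cmod (scal d q w $ i)" for i
  proof -
    have "0 < norm p" using assms by (metis less_le_trans zero_less_norm_iff)
    then show ?thesis
      using assms deg[of i] unfolding scal_def vec_lambda_beta norm_divide
      by (intro divide_left_mono mult_pos_pos)
        (auto simp: norm_mult norm_power intro!: mult_left_mono power_mono)
  qed
  then show ?thesis
    unfolding norm_vec_def by (intro L2_set_mono) auto
qed

lemma scal_diff: "scal d p (v - w) = scal d p v - scal d p w"
  by (auto simp: scal_def vec_eq_iff diff_divide_distrib)

text \<open>Rescale \<open>p\<close> to \<open>q + u\<close> with \<open>u\<close> orthogonal to
  \<open>q\<close>. A vector \<open>w\<close> of \<open>perp q\<close> is nearly orthogonal to this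
  point, so the bound there applies to its projection. The three subtracted terms in
  \<open>k\<close> are the loss in length by projecting, the derivative of the removed component,
  and the change of the Jacobian.\<close>

lemma cond_le_perturb:
  assumes cond: "cond_le d f p M" and M: "0 \<le> M" and q: "q \<noteq> 0"
    and pq: "dT p q \<le> ereal r"
    and k: "0 < k" "k \<le> 1 - r - M * sqrt (real D) * r - M * sqrt (real D) * ((1 + r) ^ (D - 1) - 1)"
  shows "cond_le d f q (M / k)"
proof -
  have "dT p q \<noteq> \<infinity>" using pq by auto
  then obtain c u where cu: "c \<noteq> 0" "c *s p = q + u" "hinner u q = 0" "dT p q = ereal (norm u / norm q)"
    using dT_finite_cases[OF q] by blast
  define p' where "p' = c *s p"
  have p': "p' = q + u" by (simp add: p'_def cu)
  have cond': "cond_le d f p' M"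
    unfolding p'_def using cond cu(1) deg by (intro cond_le_smult) auto
  have qp: "norm q \<le> norm p'"
    unfolding p' by (rule norm_le_add_perp[OF cu(3)])
  have nq: "norm q > 0" using q by simp
  then have p0: "p' \<noteq> 0" using qp by auto
  have ur: "norm u \<le> r * norm q"
    using pq nq by (simp add: cu(4) divide_le_eq)
  have r: "0 \<le> r" using pq nq by (metis cu(4) divide_nonneg_nonneg ereal_less_eq(3) norm_ge_zero order.trans)
  have ur': "norm (- u) \<le> r * norm p'"
    using ur mult_left_mono[OF qp r] by simp
  show ?thesis
    unfolding cond_le_def
  proof
    fix w assume w: "w \<in> perp q"
    obtain e w' where ew: "w = e *s p' + w'" "hinner w' p' = 0" "e = hinner w p' / complex_of_real ((norm p')\<^sup>2)"
      using perp_decompose[OF p0] by blast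
    \<comment> \<open>Since \<open>w\<close> is orthogonal to \<open>q\<close>, only
      \<open>u\<close> contributes, and \<open>u\<close> is short.\<close>
    have "hinner w p' = hinner w u"
      using w by (simp add: p' hinner_add_right perp_def)
    then have "cmod (hinner w p') \<le> norm w * norm u" using cmod_hinner_le[of w u] by simp
    also have "\<dots> \<le> norm w * (r * norm p')"
      using ur' by (intro mult_left_mono) auto
    finally have "cmod (hinner w p') \<le> (r * norm w) * norm p'" by (simp add: mult_ac)
    moreover have "norm (e *s p') = cmod (hinner w p') / norm p'"
      using p0 by (simp add: norm_smult ew(3) norm_divide norm_power del: of_real_power)
        (simp add: power2_eq_square)
    ultimately have ep: "norm (e *s p') \<le> r * norm w"
      using p0 by (simp add: divide_le_eq)
    have w': "(1 - r) * norm w \<le> norm w'"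
      using ep norm_triangle_ineq[of "e *s p'" w', folded ew(1)] by (simp add: algebra_simps)
    define S where "S = norm (scal d q (Jac d f q *v w))"
    define h where "h = sqrt (real D)"
    define N where "N = BWnorm d f"
    have N: "N \<ge> 0" by (simp add: N_def BWnorm_nonneg)
    have q': "q = p' + (- u)" by (simp add: p')
    have "Jac d f p' *v w = Jac d f p' *v (e *s p') + Jac d f p' *v w'"
      by (subst ew(1)) (simp only: matrix_vector_right_distrib)
    then have "Jac d f p' *v w' = Jac d f q *v w - (Jac d f (p' + (- u)) *v w - Jac d f p' *v w)
        - Jac d f p' *v (e *s p')"
      unfolding q'[symmetric] by simp
    then have "scal d p' (Jac d f p' *v w') = scal d p' (Jac d f q *v w)
        - scal d p' (Jac d f (p' + (- u)) *v w - Jac d f p' *v w) - scal d p' (Jac d f p' *v (e *s p'))"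
      by (simp add: scal_diff)
    then have "norm (scal d p' (Jac d f p' *v w')) \<le> norm (scal d p' (Jac d f q *v w))
        + norm (scal d p' (Jac d f (p' + (- u)) *v w - Jac d f p' *v w)) + norm (scal d p' (Jac d f p' *v (e *s p')))"
      by (smt (verit) norm_triangle_ineq4)
    also have "\<dots> \<le> S + N * (h * (norm w * ((1 + r) ^ (D - 1) - 1))) + N * (h * (r * norm w))"
    proof (intro add_mono)
      show "norm (scal d p' (Jac d f q *v w)) \<le> S"
        unfolding S_def by (rule norm_scal_antimono[OF q qp])
      show "norm (scal d p' (Jac d f (p' + (- u)) *v w - Jac d f p' *v w)) \<le> N * (h * (norm w * ((1 + r) ^ (D - 1) - 1)))"
        unfolding N_def h_def by (rule norm_scal_Jac_diff_le[OF p0 ur'])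
      have "norm (scal d p' (Jac d f p' *v (e *s p'))) \<le> N * (h * norm (e *s p'))"
        unfolding N_def h_def by (rule norm_scal_Jac_le[OF p0])
      also have "\<dots> \<le> N * (h * (r * norm w))"
        using ep N by (intro mult_left_mono) (auto simp: h_def)
      finally show "norm (scal d p' (Jac d f p' *v (e *s p'))) \<le> N * (h * (r * norm w))" .
    qed
    finally have "M * norm (scal d p' (Jac d f p' *v w'))
        \<le> M * (S + N * (h * (norm w * ((1 + r) ^ (D - 1) - 1))) + N * (h * (r * norm w)))"
      using M by (rule mult_left_mono)
    moreover have "N * norm w' \<le> M * norm (scal d p' (Jac d f p' *v w'))"
      using cond' ew(2) by (auto simp: cond_le_def N_def perp_def)
    moreover have "N * ((1 - r) * norm w) \<le> N * norm w'"
      using w' N by (rule mult_left_mono)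
    ultimately have "N * norm w * (1 - r - M * h * r - M * h * ((1 + r) ^ (D - 1) - 1)) \<le> M * S"
      by (simp add: algebra_simps)
    moreover have "N * norm w * k \<le> N * norm w * (1 - r - M * h * r - M * h * ((1 + r) ^ (D - 1) - 1))"
      using k(2) N unfolding h_def by (intro mult_left_mono) auto
    ultimately have "N * norm w * k \<le> M * S" by linarith
    then show "BWnorm d f * norm w \<le> M / k * norm (scal d q (Jac d f q *v w))"
      using k(1) by (simp add: N_def S_def field_simps)
  qed
qed

end

subsection \<open>Newton's method\<close>

text \<open>The case \<open>k = 2\<close> is the definition of \<open>G\<close>; each later binomial
  coefficient grows by at most \<open>real D / 2\<close>, which is at most \<open>G\<close>.\<close>

lemma choose_le_power:
  fixes M :: real
  assumes n: "1 \<le> n" "n \<le> D" and M: "1 \<le> M * sqrt (real D)" "0 \<le> M"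
    and G: "G = real D * sqrt (real D) / 2 * M" and k: "2 \<le> k"
  shows "M * real (n choose k) \<le> sqrt (real n) * G ^ (k - 1)"
  using k
proof (induction k rule: dec_induct)
  case base
  have "real (n choose 2) = real n * (real n - 1) / 2"
    using n(1) by (simp add: choose_two real_of_nat_div of_nat_diff)
  also have "\<dots> = sqrt (real n) * (sqrt (real n) * (real n - 1) / 2)"
    by (simp add: mult.assoc[symmetric])
  also have "\<dots> \<le> sqrt (real n) * (sqrt (real D) * real D / 2)"
    using n by (intro mult_left_mono divide_right_mono mult_mono) auto
  finally have "M * real (n choose 2) \<le> M * (sqrt (real n) * (sqrt (real D) * real D / 2))"
    using M(2) by (rule mult_left_mono)
  then show ?case by (simp add: G mult_ac)
next
  case (step k)
  \<comment> \<open>Here the weak lower bound on the condition number enters.\<close>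
  have "real D \<le> real D * (M * sqrt (real D))"
    using mult_left_mono[OF M(1), of "real D"] by simp
  then have DG: "real D / 2 \<le> G" by (simp add: G mult_ac)
  have "Suc k * (n choose Suc k) = (n - k) * (n choose k)"
    using binomial_absorb_comp[of n k] binomial_absorption[of k n] by (cases n) auto
  then have "real (Suc k) * real (n choose Suc k) = real (n - k) * real (n choose k)"
    by (metis of_nat_mult)
  also have "\<dots> \<le> real D * real (n choose k)"
    using n by (intro mult_right_mono) auto
  finally have "real (Suc k) * real (n choose Suc k) \<le> real D * real (n choose k)" .
  moreover have "2 * real (n choose Suc k) \<le> real (Suc k) * real (n choose Suc k)"
    using step.hyps by (intro mult_right_mono) auto
  ultimately have "2 * real (n choose Suc k) \<le> real D * real (n choose k)"
    by (rule order.trans[rotated])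
  then have "real (n choose Suc k) \<le> G * real (n choose k)"
    using mult_right_mono[OF DG, of "real (n choose k)"] by simp
  then have "M * real (n choose Suc k) \<le> G * (M * real (n choose k))"
    using mult_left_mono[of _ _ M] M(2) by (metis mult.left_commute)
  also have "\<dots> \<le> G * (sqrt (real n) * G ^ (k - 1))"
    using DG by (intro mult_left_mono step.IH) auto
  also have "\<dots> = sqrt (real n) * G ^ (Suc k - 1)"
    using step.hyps by (cases k) auto
  finally show ?case .
qed

lemma geometric_tail: "(\<Sum>k=2..Suc m. q ^ (k - 1)) * (1 - q) = q - q ^ Suc m" for q :: real
proof (induction m)
  case (Suc m)
  have "(\<Sum>k=2..Suc (Suc m). q ^ (k - 1)) = (\<Sum>k=2..Suc m. q ^ (k - 1)) + q ^ Suc m"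
    by (subst sum.cl_ivl_Suc) simp
  then show ?case
    by (simp only: distrib_right Suc) (simp add: algebra_simps)
qed simp

lemma taylor_majorant:
  fixes M :: real
  assumes n: "1 \<le> n" "n \<le> D" and M: "1 \<le> M * sqrt (real D)" "0 \<le> M"
    and G: "G = real D * sqrt (real D) / 2 * M" and t: "0 \<le> t" "G * t < 1"
  shows "M * (\<Sum>k=2..n. real (n choose k) * t ^ k) \<le> sqrt (real n) * (G * t\<^sup>2 / (1 - G * t))"
proof -
  obtain m where m: "n = Suc m" using n by (cases n) auto
  have G0: "0 \<le> G" using M by (simp add: G)
  have "M * (\<Sum>k=2..n. real (n choose k) * t ^ k) = (\<Sum>k=2..n. (M * real (n choose k)) * t ^ k)"
    by (simp add: sum_distrib_left mult.assoc)
  also have "\<dots> \<le> (\<Sum>k=2..n. (sqrt (real n) * G ^ (k - 1)) * t ^ k)"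
    by (intro sum_mono mult_right_mono choose_le_power[OF n M G]) (use t in auto)
  also have "\<dots> = (\<Sum>k=2..n. sqrt (real n) * t * (G * t) ^ (k - 1))"
  proof (intro sum.cong refl)
    fix k assume "k \<in> {2..n}"
    then obtain l where "k = Suc l" by (cases k) auto
    then show "(sqrt (real n) * G ^ (k - 1)) * t ^ k = sqrt (real n) * t * (G * t) ^ (k - 1)"
      by (simp add: power_mult_distrib)
  qed
  also have "\<dots> = sqrt (real n) * t * (\<Sum>k=2..n. (G * t) ^ (k - 1))"
    by (simp add: sum_distrib_left)
  also have "\<dots> \<le> sqrt (real n) * t * (G * t / (1 - G * t))"
  proof (intro mult_left_mono)
    have "(\<Sum>k=2..n. (G * t) ^ (k - 1)) * (1 - G * t) \<le> G * t"
      unfolding m geometric_tail using G0 t by simp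
    then show "(\<Sum>k=2..n. (G * t) ^ (k - 1)) \<le> G * t / (1 - G * t)"
      using t by (simp add: le_divide_eq)
  qed (use t in auto)
  finally show ?thesis by (simp add: power2_eq_square mult_ac)
qed

context
  fixes d :: "'m::finite \<Rightarrow> nat" and D :: nat
  assumes deg: "\<And>i. 1 \<le> d i" and degD: "\<And>i. d i \<le> D"
begin

text \<open>\<open>b\<close> is the preimage in \<open>perp z\<close> of a second order Taylor
  remainder. Its components are bounded by \<open>taylor_majorant\<close>, whose factor
  \<open>sqrt (real n)\<close> cancels against \<open>scal\<close>; \<open>cond_le\<close> then
  bounds \<open>b\<close> itself.\<close>

lemma newton_remainder:
  assumes cond: "cond_le d f z M" and N: "BWnorm d f > 0" and z: "z \<noteq> 0"
    and M: "1 \<le> M * sqrt (real D)" and G: "G = real D * sqrt (real D) / 2 * M"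
    and v: "norm v \<le> t * norm z" and t: "G * t < 1"
    and b: "b \<in> perp z" "Jac d f z *v b = peval d f (z + v) - peval d f z - Jac d f z *v v"
  shows "norm b \<le> G * t\<^sup>2 / (1 - G * t) * norm z"
proof -
  have M0: "0 < M" using M by (smt (verit) mult_nonpos_nonneg real_sqrt_ge_zero of_nat_0_le_iff)
  have nz: "0 < norm z" using z by simp
  have t0: "0 \<le> t" using v nz norm_ge_zero[of v] by (metis order.trans zero_le_mult_iff not_less)
  define S where "S = G * t\<^sup>2 / (1 - G * t)"
  have G0: "0 \<le> G" using M0 by (simp add: G)
  have S0: "0 \<le> S" using G0 t by (simp add: S_def)
  have "norm (scal d z (Jac d f z *v b)) \<le> BWnorm d f * (norm z * (S / M))"
  proof (rule norm_le_BWnorm)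
    show "0 \<le> norm z * (S / M)" using S0 M0 by simp
    fix i
    obtain m where m: "d i = Suc m" using deg[of i] by (cases "d i") auto
    let ?n = "Suc m"
    have n: "1 \<le> ?n" "?n \<le> D" using degD[of i] m by auto
    have "(\<Sum>k=2..?n. real (?n choose k) * norm v ^ k * norm z ^ (?n - k))
        \<le> (\<Sum>k=2..?n. norm z ^ ?n * (real (?n choose k) * t ^ k))"
    proof (rule sum_mono)
      fix k assume "k \<in> {2..?n}"
      then have "norm z ^ ?n = norm z ^ k * norm z ^ (?n - k)" by (simp add: power_add[symmetric])
      moreover have "norm v ^ k \<le> t ^ k * norm z ^ k"
        unfolding power_mult_distrib[symmetric] using v by (intro power_mono) auto
      then have "real (?n choose k) * norm v ^ k * norm z ^ (?n - k) \<le> real (?n choose k) * (t ^ k * norm z ^ k) * norm z ^ (?n - k)"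
        by (intro mult_right_mono mult_left_mono) auto
      ultimately show "real (?n choose k) * norm v ^ k * norm z ^ (?n - k) \<le> norm z ^ ?n * (real (?n choose k) * t ^ k)"
        by (simp add: mult_ac)
    qed
    also have "\<dots> = norm z ^ ?n * (\<Sum>k=2..?n. real (?n choose k) * t ^ k)"
      by (simp only: sum_distrib_left)
    also have "(\<Sum>k=2..?n. real (?n choose k) * t ^ k) \<le> sqrt (real ?n) * S / M"
      using taylor_majorant[OF n M less_imp_le[OF M0] G t0 t, folded S_def]
      unfolding pos_le_divide_eq[OF M0] by (simp only: mult.commute)
    finally have sum_le: "(\<Sum>k=2..?n. real (?n choose k) * norm v ^ k * norm z ^ (?n - k))
        \<le> norm z ^ ?n * (sqrt (real ?n) * S / M)"
      by (simp add: mult_left_mono del: sum.cl_ivl_Suc of_nat_Suc power_Suc)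
    have "cmod (hev ?n (f i) (z + v) - hev ?n (f i) z - hev m (dirder v (f i)) z)
      \<le> bw ?n (f i) * (\<Sum>k=2..?n. real (?n choose k) * norm v ^ k * norm z ^ (?n - k))"
      by (rule cmod_hev_taylor2_le)
    also have "\<dots> \<le> bw ?n (f i) * (norm z ^ ?n * (sqrt (real ?n) * S / M))"
      by (intro mult_left_mono sum_le) auto
    finally have "cmod (hev ?n (f i) (z + v) - hev ?n (f i) z - hev m (dirder v (f i)) z) / (sqrt (real ?n) * norm z ^ m)
      \<le> bw ?n (f i) * (norm z ^ ?n * (sqrt (real ?n) * S / M)) / (sqrt (real ?n) * norm z ^ m)"
      by (intro divide_right_mono) auto
    also have "\<dots> = bw ?n (f i) * (norm z * (S / M))"
      using nz by simp
    finally show "cmod (scal d z (Jac d f z *v b) $ i) \<le> bw (d i) (f i) * (norm z * (S / M))"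
      unfolding b(2) using deg
      by (simp add: scal_def peval_nth Jac_mult_nth m norm_divide norm_mult norm_power del: of_nat_Suc)
  qed
  then have "M * norm (scal d z (Jac d f z *v b)) \<le> M * (BWnorm d f * (norm z * (S / M)))"
    using M0 by (intro mult_left_mono) auto
  also have "\<dots> = BWnorm d f * (S * norm z)" using M0 by simp
  finally have "BWnorm d f * norm b \<le> BWnorm d f * (S * norm z)"
    using cond b(1) by (auto simp: cond_le_def intro: order.trans)
  then have "norm b \<le> S * norm z" using N by simp
  then show ?thesis by (simp add: S_def)
qed

text \<open>Compares, on one nonzero vector of \<open>perp z\<close>, the lower bound
  \<open>cond_le\<close> with the upper bound \<open>norm_scal_Jac_le\<close> on the same
  derivative.\<close>

lemma one_le_cond:
  assumes cond: "cond_le d f z M" and N: "BWnorm d f > 0" and z: "z \<noteq> 0"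
    and bij: "bij_betw (\<lambda>v. Jac d f z *v v) (perp z) UNIV"
  shows "1 \<le> M * sqrt (real D)"
proof -
  \<comment> \<open>The all-ones vector serves as a nonzero right-hand side, so \<open>v\<close> is
    nonzero.\<close>
  define v where "v = RInv d f z 1"
  have v: "v \<in> perp z" "Jac d f z *v v = 1"
    unfolding v_def by (rule RInv_solves[OF bij])+
  have "v \<noteq> 0" using v(2) by (auto simp: matrix_vector_mult_0_right)
  then have Nv: "0 < BWnorm d f * norm v" using N by simp
  have 1: "BWnorm d f * norm v \<le> M * norm (scal d z (Jac d f z *v v))"
    using cond v by (auto simp: cond_le_def)
  have "0 < M" using 1 Nv by (smt (verit) mult_nonpos_nonneg norm_ge_zero)
  then have "M * norm (scal d z (Jac d f z *v v)) \<le> M * (BWnorm d f * (sqrt (real D) * norm v))"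
    by (intro mult_left_mono norm_scal_Jac_le[OF deg degD z]) auto
  with 1 have "1 * (BWnorm d f * norm v) \<le> (M * sqrt (real D)) * (BWnorm d f * norm v)"
    by (simp add: mult_ac)
  then show ?thesis using Nv by (simp only: mult_le_cancel_right_pos)
qed

text \<open>The Newton error is exactly the Taylor remainder at \<open>z\<close>, because the zero, rescaled
  into the affine space \<open>z + perp z\<close>, is seen by the Newton step at \<open>z\<close>.\<close>
lemma newton_step_dT:
  assumes cond: "cond_le d f z M" and N: "BWnorm d f > 0" and z: "z \<noteq> 0"
    and bij: "bij_betw (\<lambda>v. Jac d f z *v v) (perp z) UNIV"
    and M: "1 \<le> M * sqrt (real D)" and G: "G = real D * sqrt (real D) / 2 * M"
    and \<zeta>: "peval d f \<zeta> = 0" and dT: "dT \<zeta> z = ereal t" and t: "G * t < 1"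
    and s: "G * t\<^sup>2 / (1 - G * t) \<le> s" "s < 1"
  shows "newton d f z \<noteq> 0" "dT \<zeta> (newton d f z) \<le> ereal (s / (1 - s))"
proof -
  obtain c u where cu: "c \<noteq> 0" "c *s \<zeta> = z + u" "hinner u z = 0" "dT \<zeta> z = ereal (norm u / norm z)"
    using dT_finite_cases[OF z, of \<zeta>] dT by auto
  have nu: "norm u \<le> t * norm z" using dT cu(4) z by (auto simp: field_simps)
  define a where "a = - RInv d f z (peval d f z)"
  have nwt: "newton d f z = z + a" by (simp add: newton_def a_def)
  have a: "a \<in> perp z" "Jac d f z *v a = - peval d f z"
    unfolding a_def using RInv_solves[OF bij, of "peval d f z"]
    by (auto simp: perp_minus mat_vec_scaleR[of _ "-1", simplified])
  have F: "peval d f (z + u) = 0"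
    using peval_smult_eq_0[OF \<zeta>, of c] cu(2) by simp
  have ab: "a - u \<in> perp z"
    using a cu(3) by (intro perp_diff) (auto simp: perp_def)
  have "Jac d f z *v (a - u) = peval d f (z + u) - peval d f z - Jac d f z *v u"
    by (simp add: F a matrix_vector_mult_diff_distrib)
  from newton_remainder[OF cond N z M G nu t ab this]
  have "norm (a - u) \<le> s * norm z"
    using mult_right_mono[OF s(1) norm_ge_zero[of z]] by linarith
  note * = dT_le_of_dist[OF z _ cu(3) this s(2)]
  show "newton d f z \<noteq> 0"
    unfolding nwt using a by (intro *(1)) (simp add: perp_def)
  have "dT (z + a) (z + u) \<le> ereal (s / (1 - s))"
    using a by (intro *(2)) (simp add: perp_def)
  then show "dT \<zeta> (newton d f z) \<le> ereal (s / (1 - s))"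
    by (simp add: nwt cu(2)[symmetric] dT_commute[of "z + a"] dT_smult_left[OF cu(1)])
qed

end

text \<open>Squaring doubles the exponent \<open>2^p - 1\<close>, and
  \<open>K * \<tau> \<le> 1/2\<close> supplies one more factor \<open>1/2\<close>, which gives
  \<open>2^(p+1) - 1\<close>. The errors never exceed the first one, so \<open>step\<close> stays
  applicable.\<close>

lemma approx_zero_of_quadratic:
  assumes \<zeta>: "peval d f \<zeta> = 0" and K: "0 \<le> K" "K * \<tau> \<le> 1/2"
    and step: "\<And>z. z \<noteq> 0 \<Longrightarrow> dT \<zeta> z \<le> ereal \<tau> \<Longrightarrow> newton_defined d f z \<and> newton d f z \<noteq> 0 \<and>
       (\<exists>t\<ge>0. dT \<zeta> z = ereal t \<and> dT \<zeta> (newton d f z) \<le> ereal (K * t\<^sup>2))"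
    and z: "z \<noteq> 0" "dT \<zeta> z \<le> ereal \<tau>"
  shows "approx_zero d f z \<zeta>"
proof -
  obtain t0 where t0: "0 \<le> t0" "dT \<zeta> z = ereal t0" using step[OF z] by auto
  have t0\<tau>: "t0 \<le> \<tau>" using z(2) t0(2) by simp
  define zp where "zp p = (newton d f ^^ p) z" for p
  have le\<tau>: "(1/2) ^ (2 ^ p - 1) * t0 \<le> \<tau>" for p :: nat
  proof -
    have "(1/2) ^ (2 ^ p - 1) * t0 \<le> 1 * t0"
      by (intro mult_right_mono power_le_one) (use t0 in auto)
    then show ?thesis using t0\<tau> by simp
  qed
  have main: "zp p \<noteq> 0 \<and> dT \<zeta> (zp p) \<le> ereal ((1/2) ^ (2 ^ p - 1) * t0)" for p
  proof (induction p)
    case 0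
    then show ?case using z t0 by (simp add: zp_def)
  next
    case (Suc p)
    have "dT \<zeta> (zp p) \<le> ereal \<tau>"
      using Suc le\<tau>[of p] by (meson ereal_less_eq(3) order.trans)
    from step[OF _ this] Suc obtain t where t: "0 \<le> t" "dT \<zeta> (zp p) = ereal t"
      and nz: "newton d f (zp p) \<noteq> 0" and le: "dT \<zeta> (newton d f (zp p)) \<le> ereal (K * t\<^sup>2)"
      by blast
    let ?e = "(2::nat) ^ p - 1"
    \<comment> \<open>Subtraction of naturals: the identity needs \<open>2 ^ p\<close> to be at
      least 1.\<close>
    have e: "2 ^ Suc p - 1 = Suc (?e + ?e)"
    proof -
      have "(1::nat) \<le> 2 ^ p" by simp
      then show ?thesis unfolding power_Suc by linarith
    qed
    have "t \<le> (1/2) ^ ?e * t0" using Suc t by simp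
    then have "K * t\<^sup>2 \<le> K * ((1/2) ^ ?e * t0)\<^sup>2"
      using K t by (intro mult_left_mono power_mono) auto
    also have "\<dots> = ((1/2) ^ ?e * (1/2) ^ ?e) * t0 * (K * t0)"
      by (simp add: power2_eq_square mult_ac)
    also have "\<dots> \<le> ((1/2) ^ ?e * (1/2) ^ ?e) * t0 * (1/2)"
      using K t0\<tau> t0 mult_left_mono[OF t0\<tau> K(1)] by (intro mult_left_mono) auto
    also have "\<dots> = (1/2) ^ (2 ^ Suc p - 1) * t0"
      unfolding e unfolding power_Suc power_add by (simp only: mult_ac)
    finally have "dT \<zeta> (newton d f (zp p)) \<le> ereal ((1/2) ^ (2 ^ Suc p - 1) * t0)"
      using le by (meson ereal_less_eq(3) order.trans)
    then show ?case using nz by (simp add: zp_def)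
  qed
  have "newton_defined d f (zp p)" for p
    using step[of "zp p"] main[of p] le\<tau>[of p] by (meson ereal_less_eq(3) order.trans)
  then show ?thesis
    using main z \<zeta> by (simp add: approx_zero_def zp_def t0(2))
qed

text \<open>With \<open>s = sigma a\<close>, the equation
  \<open>s = 1 + a * s^2 / (1 - a * s)\<close> clears to
  \<open>2 * a * s^2 - (1 + a) * s + 1 = 0\<close>, and \<open>sigma a\<close> is the smaller root.
  It is the fixed point equation of the majorant with \<beta> scaled to 1.\<close>

lemma sigma_props:
  assumes a: "0 < a" "a \<le> (13 - 3 * sqrt 17) / 4"
  shows "0 \<le> sigma a" "a * sigma a < 1"
    "a * (sigma a)\<^sup>2 / (1 - a * sigma a) = sigma a - 1"
    "a \<le> 0.049 \<Longrightarrow> a * sigma a \<le> 0.052"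
proof -
  \<comment> \<open>This makes \<open>(13 - 3 * 4.12) / 4 = 4/25\<close> a rational bound for
    \<open>a\<close>, small enough for the discriminant \<open>1 - 6 * a + a * a\<close> to be
    positive.\<close>
  have "4.12 \<le> sqrt (17::real)" by (rule real_le_rsqrt) (simp add: power2_eq_square)
  then have a16: "a \<le> 4/25" using a(2) by simp
  define r where "r = sqrt ((1 + a)\<^sup>2 - 8 * a)"
  have "0 \<le> (1 + a)\<^sup>2 - 8 * a"
  proof -
    have "(1 + a)\<^sup>2 - 8 * a = 1 - 6 * a + a * a" by (simp add: power2_eq_square algebra_simps)
    then show ?thesis using a16 zero_le_square[of a] by linarith
  qed
  then have r2: "r\<^sup>2 = (1 + a)\<^sup>2 - 8 * a" and r0: "0 \<le> r" by (auto simp: r_def)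
  have "r\<^sup>2 \<le> (1 + a)\<^sup>2" using r2 a by simp
  then have r1: "r \<le> 1 + a" by (rule power2_le_imp_le) (use a in simp)
  have s: "sigma a = (1 + a - r) / (4 * a)"
    using a(1) by (simp add: sigma_def r_def field_simps)
  have as: "a * sigma a = (1 + a - r) / 4" using a(1) by (simp add: s)
  show "0 \<le> sigma a" using r1 a(1) by (simp add: s)
  show lt: "a * sigma a < 1" using r0 a16 by (simp add: as)
  have "4 * (a * sigma a) - (1 + a) = - r" unfolding as by (simp add: field_simps)
  then have "(4 * (a * sigma a) - (1 + a))\<^sup>2 = (1 + a)\<^sup>2 - 8 * a" by (simp only: r2 power2_minus)
  then have "a * (2 * a * (sigma a)\<^sup>2 - (1 + a) * sigma a + 1) = 0"
    by (simp add: power2_eq_square algebra_simps)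
  then have "2 * a * (sigma a)\<^sup>2 - (1 + a) * sigma a + 1 = 0" using a(1) by simp
  then have "a * (sigma a)\<^sup>2 = (sigma a - 1) * (1 - a * sigma a)"
    by (simp add: power2_eq_square algebra_simps)
  then show "a * (sigma a)\<^sup>2 / (1 - a * sigma a) = sigma a - 1" using lt by simp
  assume "a \<le> 0.049"
  \<comment> \<open>The constant is \<open>1 - 4 * 0.052\<close>, so \<open>(1 + a - r) / 4\<close>
    becomes at most \<open>0.052\<close>.\<close>
  then have "(0.792 + a)\<^sup>2 \<le> r\<^sup>2" unfolding r2 by (simp add: power2_eq_square algebra_simps)
  then have "0.792 + a \<le> r" by (rule power2_le_imp_le) (rule r0)
  then show "a * sigma a \<le> 0.052" by (simp add: as)
qed

lemma continuous_on_peval: "continuous_on S (peval d f)"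
  unfolding peval_def by (intro continuous_intros)

text \<open>Zeros of \<open>f\<close> in \<open>x + perp x\<close> are the fixed points of the simplified Newton map with frozen
  derivative, and the majorant series makes that map preserve a ball.\<close>
lemma exists_zero:
  fixes d :: "'m::finite \<Rightarrow> nat" and D :: nat
  assumes deg: "\<And>i. 1 \<le> d i" and degD: "\<And>i. d i \<le> D"
    and cond: "cond_le d f x M" and N: "BWnorm d f > 0" and x: "x \<noteq> 0"
    and bij: "bij_betw (\<lambda>v. Jac d f x *v v) (perp x) UNIV"
    and M: "1 \<le> M * sqrt (real D)" and G: "G = real D * sqrt (real D) / 2 * M"
    and t: "0 \<le> t" "G * t < 1" "G * t\<^sup>2 / (1 - G * t) \<le> t - beta0 d f x"
  obtains \<zeta> where "\<zeta> \<noteq> 0" "peval d f \<zeta> = 0" "dT x \<zeta> \<le> ereal t"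
    "dR (newton d f x) \<zeta> \<le> t - beta0 d f x"
proof -
  define A where "A = RInv d f x"
  note A = RInv_solves[OF bij, folded A_def]
  have nx: "0 < norm x" using x by simp
  have beta: "norm (A (peval d f x)) = beta0 d f x * norm x"
    using nx by (simp add: beta0_def A_def)
  define H where "H v = v - A (peval d f (x + v))" for v
  define S where "S = perp x \<inter> cball 0 (t * norm x)"
  \<comment> \<open>The vector is the displacement of \<open>H v\<close> from the Newton step
    \<open>- A (peval d f x)\<close>. The estimate is used twice: for invariance of the ball, and at
    the fixed point for the distance from the Newton iterate.\<close>
  have rem: "norm (H v + A (peval d f x)) \<le> (t - beta0 d f x) * norm x" if v: "v \<in> S" for v
  proof -
    define b where "b = - (H v + A (peval d f x))"
    have vp: "v \<in> perp x" and nv: "norm v \<le> t * norm x" using v by (auto simp: S_def)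
    have b: "b \<in> perp x"
      unfolding b_def H_def using A(1) vp by (intro perp_minus perp_add perp_diff)
    have "b = A (peval d f (x + v)) - A (peval d f x) - v" by (simp add: b_def H_def)
    then have "Jac d f x *v b = peval d f (x + v) - peval d f x - Jac d f x *v v"
      by (simp add: matrix_vector_mult_diff_distrib A(2))
    from newton_remainder[OF deg degD cond N x M G nv t(2) b this]
    have "norm b \<le> (t - beta0 d f x) * norm x"
      using mult_right_mono[OF t(3) norm_ge_zero[of x]] by linarith
    then show ?thesis unfolding b_def norm_minus_cancel .
  qed
  have "linear A" unfolding A_def by (rule linear_RInv[OF bij])
  then have contA: "continuous_on T A" for T by (rule linear_continuous_on[OF linear_conv_bounded_linear[THEN iffD1]])
  have "linear (\<lambda>v. hinner v x)"
    by (auto simp: linear_iff hinner_def scaleR_sum_right distrib_right sum.distrib)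
  then have conth: "continuous_on UNIV (\<lambda>v. hinner v x)"
    by (rule linear_continuous_on[OF linear_conv_bounded_linear[THEN iffD1]])
  have "closed (perp x)"
    unfolding perp_def by (intro closed_Collect_eq conth continuous_on_const)
  then have "compact S" unfolding S_def by (intro closed_Int_compact) auto
  moreover have "convex S"
    unfolding S_def by (intro convex_Int convex_cball) (auto simp: convex_def intro: perp_add perp_scaleR)
  moreover have "0 \<in> S" using t(1) by (simp add: S_def perp_def hinner_def)
  moreover have "continuous_on S H"
    unfolding H_def
    by (intro continuous_intros continuous_on_compose2[OF contA[of UNIV]] continuous_on_compose2[OF continuous_on_peval[of UNIV]]) auto
  moreover have "H \<in> S \<rightarrow> S"
  proof
    fix v assume v: "v \<in> S"
    have "H v \<in> perp x" using v A(1) unfolding H_def by (intro perp_diff) (auto simp: S_def)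
    moreover have "norm (H v) \<le> norm (H v + A (peval d f x)) + norm (A (peval d f x))"
      using norm_triangle_ineq4[of "H v + A (peval d f x)" "A (peval d f x)"] by simp
    then have "norm (H v) \<le> t * norm x"
      using rem[OF v] by (simp add: beta algebra_simps)
    ultimately show "H v \<in> S" by (simp add: S_def)
  qed
  ultimately obtain v where v: "v \<in> S" "H v = v" using brouwer[of S H] by blast
  have hv: "hinner v x = 0" and nv: "norm v \<le> t * norm x" using v(1) by (auto simp: S_def perp_def)
  have "A (peval d f (x + v)) = 0" using v(2) by (simp add: H_def)
  then have F: "peval d f (x + v) = 0" using A(2)[of "peval d f (x + v)"] by simp
  have nz: "x + v \<noteq> 0" using norm_le_add_perp[OF hv] nx by auto
  have "dT x (x + v) = ereal (norm v / norm x)"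
    using dT_smult_add_perp[OF x _ hv, of 1] by (simp add: dT_commute)
  then have d1: "dT x (x + v) \<le> ereal t" using nv nx by (simp add: divide_le_eq)
  have ha: "hinner (- A (peval d f x)) x = 0"
    using perp_minus[OF A(1)] by (simp add: perp_def)
  have "dR (x + - A (peval d f x)) (x + v) \<le> norm (- A (peval d f x) - v) / norm x"
    by (rule dR_le_dist[OF x ha hv])
  also have "norm (- A (peval d f x) - v) = norm (H v + A (peval d f x))"
    using norm_minus_commute[of "- A (peval d f x)" v] by (simp add: v(2))
  also have "\<dots> / norm x \<le> t - beta0 d f x"
    using rem[OF v(1)] nx by (simp add: divide_le_eq)
  finally have "dR (newton d f x) (x + v) \<le> t - beta0 d f x"
    by (simp add: newton_def A_def)
  then show ?thesis using that nz F d1 by blast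
qed

text \<open>With \<open>y = real D * r\<close> the power is at most \<open>exp y\<close>, hence at
  most \<open>1 + y + y^2\<close>, and \<open>y^2\<close> is at most
  \<open>0.104 * y\<close>.\<close>

lemma power_1_plus_bound:
  fixes r :: real
  assumes "0 \<le> r" "real D * r \<le> 0.104"
  shows "(1 + r) ^ (D - 1) - 1 \<le> 1.104 * (real D * r)"
proof -
  have "(1 + r) ^ (D - 1) \<le> (1 + r) ^ D"
    using assms by (intro power_increasing) auto
  also have "\<dots> \<le> exp r ^ D"
    using assms by (intro power_mono exp_ge_add_one_self_aux) (auto simp: exp_ge_add_one_self)
  also have "\<dots> = exp (real D * r)" by (simp add: exp_of_nat_mult)
  also have "\<dots> \<le> 1 + real D * r + (real D * r)\<^sup>2"
    using assms by (intro exp_bound) auto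
  also have "(real D * r)\<^sup>2 \<le> 0.104 * (real D * r)"
    unfolding power2_eq_square using assms by (intro mult_right_mono) auto
  finally show ?thesis by (simp add: field_simps)
qed

text \<open>The condition bound is carried from \<open>x\<close> to \<zeta> and from there to any
  \<open>z\<close> within \<open>r\<close> of \<zeta>, so no triangle inequality for
  \<open>dT\<close> is needed. The Newton iterate of \<open>x\<close> lies in the same neighbourhood
  and inherits the conclusion.\<close>

lemma approx_zero_near:
  fixes d :: "'m::finite \<Rightarrow> nat" and f :: "'m \<Rightarrow> ('n::finite \<Rightarrow> nat) \<Rightarrow> complex"
  assumes dims: "CARD('n) = CARD('m) + 1"
    and deg: "\<And>i. 1 \<le> d i" and degD: "\<And>i. d i \<le> D" and D2: "2 \<le> D"
    and cond: "cond_le d f x M" and N: "BWnorm d f > 0" and x: "x \<noteq> 0"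
    and M: "1 \<le> M * sqrt (real D)" and G: "G = real D * sqrt (real D) / 2 * M"
    and \<zeta>: "\<zeta> \<noteq> 0" "peval d f \<zeta> = 0" and r: "dT x \<zeta> \<le> ereal r" "0 \<le> r" "G * r \<le> 0.052"
  shows "approx_zero d f x \<zeta>" "approx_zero d f (newton d f x) \<zeta>"
proof -
  define h where "h = M * sqrt (real D)"
  have h: "1 \<le> h" using M by (simp add: h_def)
  have Gh: "G = real D * h / 2" by (simp add: G h_def)
  have M0: "0 < M" using M by (smt (verit) mult_nonpos_nonneg real_sqrt_ge_zero of_nat_0_le_iff)
  have Dhr: "h * (real D * r) \<le> 0.104" using r(3) by (simp add: Gh mult_ac)
  have Dr: "real D * r \<le> 0.104"
    using Dhr mult_right_mono[OF h, of "real D * r"] r(2) by simp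
  have "2 * (h * r) \<le> real D * (h * r)" using D2 r(2) h by (intro mult_right_mono) auto
  then have hr: "h * r \<le> 0.052" using Dhr by (simp add: mult_ac)
  have r52: "r \<le> 0.052" using hr mult_right_mono[OF h, of r] r(2) by simp
  define e where "e = (1 + r) ^ (D - 1) - 1"
  have "h * e \<le> h * (1.104 * (real D * r))"
    unfolding e_def using h power_1_plus_bound[OF r(2) Dr] by (intro mult_left_mono) auto
  then have he: "h * e \<le> 0.115" using Dhr by (simp add: mult_ac)
  have c1: "cond_le d f \<zeta> (M / (3/4))"
  proof (rule cond_le_perturb[OF deg degD cond _ \<zeta>(1) r(1)])
    \<comment> \<open>The right side is at least \<open>1 - 0.052 - 0.052 - 0.115 = 0.781\<close>.
      The second move loses at most a factor \<open>2/3\<close>, and \<open>3/4 * 2/3 = 1/2\<close>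
      gives \<open>2 * M\<close>.\<close>
    show "3/4 \<le> 1 - r - M * sqrt (real D) * r - M * sqrt (real D) * ((1 + r) ^ (D - 1) - 1)"
      unfolding h_def[symmetric] e_def[symmetric] using r52 hr he by simp
  qed (use M0 in auto)
  have c2: "cond_le d f z (2 * M)" if z: "z \<noteq> 0" "dT \<zeta> z \<le> ereal r" for z
  proof -
    have "cond_le d f z (M / (3/4) / (2/3))"
    proof (rule cond_le_perturb[OF deg degD c1 _ z(1) z(2)])
      have eq: "M / (3/4) * sqrt (real D) = 4/3 * h" by (simp add: h_def)
      show "2/3 \<le> 1 - r - M / (3/4) * sqrt (real D) * r - M / (3/4) * sqrt (real D) * ((1 + r) ^ (D - 1) - 1)"
        unfolding eq e_def[symmetric] using r52 hr he by (simp add: mult_ac)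
    qed (use M0 in auto)
    then show ?thesis by simp
  qed
  \<comment> \<open>The product of \<open>2 * G\<close> (from the doubled condition bound),
    \<open>5/4\<close> (for \<open>1 / (1 - 2 * G * t)\<close>) and \<open>8/5\<close> (for
    \<open>1 / (1 - s)\<close>).\<close>
  define K where "K = 4 * G"
  have G0: "0 \<le> G" using h by (simp add: Gh)
  have K: "0 \<le> K" "K * r \<le> 1/2" using G0 r(3) by (auto simp: K_def)
  have step: "newton_defined d f z \<and> newton d f z \<noteq> 0 \<and>
       (\<exists>t\<ge>0. dT \<zeta> z = ereal t \<and> dT \<zeta> (newton d f z) \<le> ereal (K * t\<^sup>2))"
    if z: "z \<noteq> 0" "dT \<zeta> z \<le> ereal r" for z
  proof -
    note cz = c2[OF z]
    have bij: "bij_betw (\<lambda>v. Jac d f z *v v) (perp z) UNIV"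
      by (rule cond_le_bij[OF dims N cz z(1)])
    obtain t where t: "dT \<zeta> z = ereal t" "0 \<le> t"
      using z dT_finite_cases[OF z(1), of \<zeta>]
      by (metis divide_nonneg_nonneg ereal_infty_less_eq(1) ereal.distinct(1) norm_ge_zero infinity_ereal_def)
    have tr: "t \<le> r" using z(2) t(1) by simp
    define s where "s = 5/4 * (2 * G) * t\<^sup>2"
    have Gt: "2 * G * t \<le> 0.104" using mult_left_mono[OF tr G0] r(3) by simp
    have G2: "2 * G = real D * sqrt (real D) / 2 * (2 * M)" by (simp add: G)
    have M2: "1 \<le> 2 * M * sqrt (real D)" using h by (simp add: h_def)
    have "2 * G * t\<^sup>2 \<le> (5/4 * (2 * G) * t\<^sup>2) * (1 - 2 * G * t)"
    proof -
      have "(2 * G * t\<^sup>2) * 1 \<le> (2 * G * t\<^sup>2) * (5/4 * (1 - 2 * G * t))"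
        using Gt G0 by (intro mult_left_mono) auto
      then show ?thesis by (simp add: algebra_simps)
    qed
    then have s: "2 * G * t\<^sup>2 / (1 - 2 * G * t) \<le> s"
      using Gt by (simp add: s_def divide_le_eq)
    have "(2 * G * t) * t \<le> 0.104 * 0.052"
      using Gt tr r52 t(2) by (intro mult_mono) auto
    then have s1: "s \<le> 0.01" by (simp add: s_def power2_eq_square mult_ac)
    have s0: "0 \<le> s" using G0 by (simp add: s_def)
    have "s / (1 - s) \<le> K * t\<^sup>2"
    proof -
      have "s * 1 \<le> s * (8/5 * (1 - s))" using s0 s1 by (intro mult_left_mono) auto
      then have "s / (1 - s) \<le> 8/5 * s" using s1 by (simp add: divide_le_eq mult_ac)
      also have "\<dots> = K * t\<^sup>2" by (simp add: s_def K_def)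
      finally show ?thesis .
    qed
    moreover have "newton d f z \<noteq> 0" "dT \<zeta> (newton d f z) \<le> ereal (s / (1 - s))"
      using newton_step_dT[OF deg degD cz N z(1) bij M2 G2 \<zeta>(2) t(1) _ s] Gt s1 by auto
    ultimately have "newton d f z \<noteq> 0" "dT \<zeta> (newton d f z) \<le> ereal (K * t\<^sup>2)"
      by (auto intro: order.trans)
    then show ?thesis using t bij z(1) by (auto simp: newton_defined_def)
  qed
  have dx: "dT \<zeta> x \<le> ereal r" using r(1) by (simp add: dT_commute)
  show "approx_zero d f x \<zeta>"
    by (rule approx_zero_of_quadratic[OF \<zeta>(2) K step x dx])
  obtain t where t: "0 \<le> t" "dT \<zeta> x = ereal t" "dT \<zeta> (newton d f x) \<le> ereal (K * t\<^sup>2)"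
    and y: "newton d f x \<noteq> 0"
    using step[OF x dx] by blast
  have tr: "t \<le> r" using dx t(2) by simp
  have "K * t\<^sup>2 \<le> (K * r) * r"
    using K(1) tr t(1) r(2) by (simp add: power2_eq_square mult.assoc mult_left_mono mult_mono)
  also have "\<dots> \<le> 1/2 * r" using K(2) r(2) by (rule mult_right_mono)
  finally have "K * t\<^sup>2 \<le> r" using r(2) by simp
  then have dy: "dT \<zeta> (newton d f x) \<le> ereal r" using t(3) by (meson ereal_less_eq(3) order.trans)
  show "approx_zero d f (newton d f x) \<zeta>"
    by (rule approx_zero_of_quadratic[OF \<zeta>(2) K step y dy])
qed

theorem theorem3:
  fixes d :: "'m::finite \<Rightarrow> nat"
    and f :: "'m \<Rightarrow> ('n::finite \<Rightarrow> nat) \<Rightarrow> complex"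
    and x :: "complex^'n"
    and \<alpha> :: real
  assumes dims: "CARD('n) = CARD('m) + 1" and n2: "CARD('m) \<ge> 2"
    and deg: "\<forall>i. d i \<ge> 1" and D2: "Max (range d) \<ge> 2"
    and Hd: "in_Hd d f" and fnz: "f \<noteq> (\<lambda>i a. 0)"
    and xnz: "x \<noteq> 0"
    and apos: "0 < \<alpha>" and a0: "\<alpha> \<le> (13 - 3 * sqrt 17) / 4"
    and rank: "(\<lambda>v. Jac d f x *v v) ` perp x = UNIV"
    and hyp: "real (Max (range d)) powr (3/2) / 2 * mu d f x * beta0 d f x \<le> \<alpha>"
  shows "\<exists>\<zeta>. \<zeta> \<noteq> 0 \<and> peval d f \<zeta> = 0
          \<and> dT x \<zeta> \<le> ereal (sigma \<alpha> * beta0 d f x)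
          \<and> dR (newton d f x) \<zeta> \<le> (sigma \<alpha> - 1) * beta0 d f x
          \<and> (\<alpha> \<le> 0.049 \<longrightarrow> approx_zero d f x \<zeta> \<and> approx_zero d f (newton d f x) \<zeta>)"
proof -
  define D where "D = Max (range d)"
  have deg1: "\<And>i. 1 \<le> d i" and degD: "\<And>i. d i \<le> D" and D: "2 \<le> D"
    using deg D2 by (auto simp: D_def)
  have N: "BWnorm d f > 0" by (rule BWnorm_pos[OF Hd fnz])
  have bij: "bij_betw (\<lambda>v. Jac d f x *v v) (perp x) UNIV"
    by (rule bij_betw_perp_of_surj[OF dims xnz rank])
  define M where "M = mu d f x"
  have cond: "cond_le d f x M"
    unfolding M_def by (rule cond_le_mu[OF deg xnz bij])
  have M: "1 \<le> M * sqrt (real D)"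
    by (rule one_le_cond[OF deg1 degD cond N xnz bij])
  define G where "G = real D * sqrt (real D) / 2 * M"
  define \<beta> where "\<beta> = beta0 d f x"
  have \<beta>: "0 \<le> \<beta>" by (simp add: \<beta>_def beta0_def)
  have "real D powr (3/2) = real D powr (1 + 1/2)" by simp
  also have "\<dots> = real D * sqrt (real D)"
    unfolding powr_add by (simp add: powr_half_sqrt)
  finally have G\<beta>: "G * \<beta> \<le> \<alpha>"
    using hyp by (simp add: D_def[symmetric] M_def[symmetric] \<beta>_def[symmetric] G_def)
  have M0: "0 < M" using M by (smt (verit) mult_nonpos_nonneg real_sqrt_ge_zero of_nat_0_le_iff)
  have G0: "0 \<le> G" using M0 by (simp add: G_def)
  define s where "s = sigma \<alpha>"
  note sp = sigma_props[OF apos a0, folded s_def]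
  define t where "t = s * \<beta>"
  have t0: "0 \<le> t" using sp(1) \<beta> by (simp add: t_def)
  have Gt: "G * t \<le> \<alpha> * s"
    using mult_right_mono[OF G\<beta> sp(1)] by (simp add: t_def mult_ac)
  \<comment> \<open>As \<open>G * \<beta> \<le> \<alpha>\<close>, the majorant at
    \<open>s * \<beta>\<close> is at most \<beta> times the normalised one, whose fixed point is
    \<open>s\<close>.\<close>
  have "G * t\<^sup>2 / (1 - G * t) \<le> (\<alpha> * s\<^sup>2 * \<beta>) / (1 - \<alpha> * s)"
  proof (rule frac_le)
    have "G * t\<^sup>2 = (G * \<beta>) * (s\<^sup>2 * \<beta>)" by (simp add: t_def power2_eq_square mult_ac)
    also have "\<dots> \<le> \<alpha> * (s\<^sup>2 * \<beta>)" using G\<beta> \<beta> by (intro mult_right_mono) auto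
    finally show "G * t\<^sup>2 \<le> \<alpha> * s\<^sup>2 * \<beta>" by (simp add: mult_ac)
  qed (use sp(2) Gt apos \<beta> in auto)
  also have "\<dots> = (s - 1) * \<beta>" using sp(3) by (metis times_divide_eq_left)
  finally have maj: "G * t\<^sup>2 / (1 - G * t) \<le> t - beta0 d f x"
    by (simp add: t_def \<beta>_def algebra_simps)
  have Gt1: "G * t < 1" using Gt sp(2) by linarith
  obtain \<zeta> where \<zeta>: "\<zeta> \<noteq> 0" "peval d f \<zeta> = 0" "dT x \<zeta> \<le> ereal t" "dR (newton d f x) \<zeta> \<le> t - beta0 d f x"
    by (rule exists_zero[OF deg1 degD cond N xnz bij M G_def t0 Gt1 maj])
  have "approx_zero d f x \<zeta> \<and> approx_zero d f (newton d f x) \<zeta>" if "\<alpha> \<le> 0.049"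
    using approx_zero_near[OF dims deg1 degD D cond N xnz M G_def \<zeta>(1,2,3) t0] Gt sp(4)[OF that] by auto
  moreover have "t - beta0 d f x = (sigma \<alpha> - 1) * beta0 d f x"
    by (simp add: t_def s_def \<beta>_def algebra_simps)
  ultimately show ?thesis
    using \<zeta> by (auto simp: t_def s_def \<beta>_def)
qed

end
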